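(* Let $m$ be an integer with $2\leq m\leq 5$. Then there exists a countably infinite family of solutions of the $(m,m)$-BVP with nodal number $0$.
   Context: For positive integers $m_0,m_1$, the $(m_0,m_1)$-ODE for a function $r:(0,\tfrac{\pi}{2})\to\mathbb{R}$ is $$\ddot r(t)=\left((m_1-m_0)\csc 2t-(m_0+m_1)\cot 2t\right)\dot r(t)-m_1\frac{\sin 2r(t)}{2\cos^2 t}+m_0\frac{\sin 2r(t)}{2\sin^2 t}.$$ A solution of the $(m_0,m_1)$-BVP is a solution $r$ of the $(m_0,m_1)$-ODE with $r(0)=0$ and $r(\tfrac{\pi}{2})=(2\ell+1)\tfrac{\pi}{2}$ for some $\ell\in\mathbb{Z}$, the boundary values being understood as limits as $t\to 0$ and $t\to\tfrac{\pi}{2}$. The $(m,m)$-BVP is the case $m_0=m_1=m$. The nodal number of $r$ is the number of $t\in(0,\tfrac{\pi}{2})$ with $r(t)=\tfrac{\pi}{2}$. *)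

theory Defs
  imports Complex_Main "HOL-Library.Extended_Nat"
begin

definition ode_rhs :: "nat \<Rightarrow> nat \<Rightarrow> real \<Rightarrow> real \<Rightarrow> real \<Rightarrow> real" where
  "ode_rhs m\<^sub>0 m\<^sub>1 t x v =
     ((real m\<^sub>1 - real m\<^sub>0) * (1 / sin (2 * t)) - (real m\<^sub>0 + real m\<^sub>1) * cot (2 * t)) * v
     - real m\<^sub>1 * (sin (2 * x) / (2 * (cos t)\<^sup>2))
     + real m\<^sub>0 * (sin (2 * x) / (2 * (sin t)\<^sup>2))"

text \<open>Only the values of \<open>r\<close> on the open interval \<open>{0<..<pi/2}\<close> matter below. As the
  interval is open, the full derivatives \<open>at t\<close> are those of the restriction.\<close>

definition ode_solution :: "nat \<Rightarrow> nat \<Rightarrow> (real \<Rightarrow> real) \<Rightarrow> bool" where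
  "ode_solution m\<^sub>0 m\<^sub>1 r \<longleftrightarrow>
     (\<exists>r'. \<forall>t\<in>{0<..<pi/2}.
        (r has_real_derivative r' t) (at t) \<and>
        (r' has_real_derivative ode_rhs m\<^sub>0 m\<^sub>1 t (r t) (r' t)) (at t))"

definition bvp_solution :: "nat \<Rightarrow> nat \<Rightarrow> (real \<Rightarrow> real) \<Rightarrow> bool" where
  "bvp_solution m\<^sub>0 m\<^sub>1 r \<longleftrightarrow>
     ode_solution m\<^sub>0 m\<^sub>1 r \<and>
     (r \<longlongrightarrow> 0) (at_right 0) \<and>
     (\<exists>l::int. (r \<longlongrightarrow> (2 * real_of_int l + 1) * (pi/2)) (at_left (pi/2)))"

text \<open>The value is in \<^typ>\<open>enat\<close> because \<^const>\<open>card\<close> is \<open>0\<close> on infinite sets.\<close>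

definition nodal_number :: "(real \<Rightarrow> real) \<Rightarrow> enat" where
  "nodal_number r =
     (let N = {t \<in> {0<..<pi/2}. r t = pi/2} in if finite N then enat (card N) else \<infinity>)"

end

theory Submission
  imports Defs "HOL-Analysis.Analysis"
begin

text \<open>In the variable \<open>x = ln (tan t)\<close> and with \<open>r = - (h + pi / 2)\<close> the equation for \<open>m\<^sub>0 = m\<^sub>1 = m\<close> reads
\<open>h'' = tanh x * ((m - 1) h' + m / 2 * sin (2 h))\<close>. It is a pendulum about \<open>h = 0\<close>, damped for
\<open>x < 0\<close> and with damping and force reversed for \<open>x > 0\<close>. A connection from \<open>- pi / 2\<close> at
minus infinity to \<open>0\<close> at plus infinity inside the strip \<open>\<bar>h\<bar> < pi / 2\<close> corresponds to a solution \<open>r\<close> from \<open>0\<close>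
to \<open>- pi / 2\<close> with values in \<open>{- pi<..<0}\<close>. Such an \<open>r\<close> may oscillate about \<open>- pi / 2\<close> as often as it likes,
and still its nodal number is \<open>0\<close>. So it suffices to find infinitely many connections.

The solutions leaving the saddle \<open>- pi / 2\<close> upwards form a family indexed by a shift \<open>L\<close>, with
\<open>h + pi / 2 ~ exp (x + L)\<close> (\<open>unstable_manifold_family\<close>). They stay in the strip up to
\<open>x = 0\<close> (\<open>strip_before_turning\<close>): an energy traps them while the damping is strong, and
close to \<open>x = 0\<close> there is too little time to leave.

In the time \<open>x + L\<close>, large shifts are close to the autonomous equation
\<open>h'' = - (m - 1) h' - m / 2 * sin (2 h)\<close>. Its equilibrium \<open>0\<close> is a focus because \<open>(m - 1)\<^sup>2 < 4 m\<close>, which is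
where \<open>m \<le> 5\<close> is used, and solutions have zeros at arbitrarily late times (\<open>autonomous_zeros\<close>). The
phase vector \<open>(h, h')\<close> turns clockwise at each zero of \<open>h\<close> (\<open>angle_crosses_down\<close>), so
the phase angle at \<open>x = 0\<close> tends to minus infinity as \<open>L\<close> grows.

A phase vector in the first quadrant at \<open>x = 0\<close> leads to an escape from the strip upwards, one in the
third quadrant to an escape downwards. Both are open conditions on \<open>L\<close>, they exclude each other, and both
occur for arbitrarily large \<open>L\<close>. By connectedness there are arbitrarily large \<open>L\<close>
without escape, and then \<open>h\<close> tends to \<open>0\<close> (\<open>no_escape_tendsto_0\<close>,
\<open>connections_for_large_shift\<close>). Different shifts give different solutions.\<close>

section \<open>Differential equations depending on a parameter\<close>

text \<open>Banach's theorem on a ball of the space of bounded continuous functions. Both existence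
results below use it on functions of (time, parameter) jointly, so that the
continuous dependence on the parameter comes with the fixed point and needs no separate estimate.\<close>

lemma bounded_continuous_fixpoint:
  fixes \<Phi> :: "('a::metric_space \<Rightarrow> 'b::banach) \<Rightarrow> 'a \<Rightarrow> 'b"
  assumes B: "0 \<le> B" and q: "0 \<le> q" "q < 1"
    and cont: "\<And>f. continuous_on UNIV f \<Longrightarrow> (\<And>x. norm (f x) \<le> B) \<Longrightarrow> continuous_on UNIV (\<Phi> f)"
    and bdd: "\<And>f x. continuous_on UNIV f \<Longrightarrow> (\<And>x. norm (f x) \<le> B) \<Longrightarrow> norm (\<Phi> f x) \<le> B"
    and lip: "\<And>f g d x. continuous_on UNIV f \<Longrightarrow> continuous_on UNIV g \<Longrightarrow>
        (\<And>x. norm (f x) \<le> B) \<Longrightarrow> (\<And>x. norm (g x) \<le> B) \<Longrightarrow>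
        (\<And>x. norm (f x - g x) \<le> d) \<Longrightarrow> norm (\<Phi> f x - \<Phi> g x) \<le> q * d"
  shows "\<exists>f. continuous_on UNIV f \<and> (\<forall>x. norm (f x) \<le> B) \<and> \<Phi> f = f"
proof -
  let ?S = "{f :: 'a \<Rightarrow>\<^sub>C 'b. \<forall>x. norm (f x) \<le> B}"
  have S_eq: "?S = cball 0 B"
  proof (intro equalityI subsetI)
    fix f :: "'a \<Rightarrow>\<^sub>C 'b" assume "f \<in> ?S"
    then show "f \<in> cball 0 B" by (auto simp: dist_norm norm_bound)
  next
    fix f :: "'a \<Rightarrow>\<^sub>C 'b" assume "f \<in> cball 0 B"
    then show "f \<in> ?S" using dist_bounded[of 0 _ f] by (auto simp: dist_norm intro: order_trans)
  qed
  have mem: "\<Phi> f \<in> bcontfun" if "f \<in> ?S" for f :: "'a \<Rightarrow>\<^sub>C 'b"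
  proof -
    have "\<And>x. norm (\<Phi> f x) \<le> B" using that by (intro bdd) auto
    then have "bounded (range (\<Phi> f))" by (auto simp: bounded_iff)
    moreover have "continuous_on UNIV (\<Phi> f)" using that by (intro cont) auto
    ultimately show ?thesis by (simp add: bcontfun_def)
  qed
  have app: "apply_bcontfun (Bcontfun (\<Phi> f)) = \<Phi> f" if "f \<in> ?S" for f :: "'a \<Rightarrow>\<^sub>C 'b"
    using mem[OF that] by (rule Bcontfun_inverse)
  have "\<exists>!f\<in>?S. Bcontfun (\<Phi> f) = f"
  proof (rule Banach_fix[OF _ _ q])
    show "complete ?S" unfolding S_eq by (intro complete_eq_closed[THEN iffD2] closed_cball)
    show "?S \<noteq> {}" unfolding S_eq using B by auto
    show "(\<lambda>f. Bcontfun (\<Phi> (apply_bcontfun f))) ` ?S \<subseteq> ?S"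
      using app by (auto intro!: bdd)
    fix f g :: "'a \<Rightarrow>\<^sub>C 'b" assume f: "f \<in> ?S" and g: "g \<in> ?S"
    show "dist (Bcontfun (\<Phi> f)) (Bcontfun (\<Phi> g)) \<le> q * dist f g"
    proof (rule dist_bound)
      fix x
      show "dist (Bcontfun (\<Phi> f) x) (Bcontfun (\<Phi> g) x) \<le> q * dist f g"
        unfolding app[OF f] app[OF g] dist_norm[of "\<Phi> f x"]
        using f g by (intro lip) (auto simp: dist_norm[symmetric] intro: dist_bounded)
    qed
  qed
  then obtain f where f: "f \<in> ?S" "Bcontfun (\<Phi> f) = f" by auto
  then have "\<Phi> f = f" using app[OF f(1)] by simp
  with f(1) show ?thesis by (intro exI[of _ "apply_bcontfun f"]) auto
qed

lemma continuous_on_unit_integral: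
  fixes f :: "'a::topological_space \<Rightarrow> real \<Rightarrow> 'b::banach"
  assumes "continuous_on UNIV (\<lambda>p. f (fst p) (snd p))"
  shows "continuous_on UNIV (\<lambda>x. integral {0..1} (f x))"
proof -
  have "continuous_on (UNIV \<times> cbox 0 1) (\<lambda>(x, t). f x t)"
    using continuous_on_subset[OF assms subset_UNIV] by (simp add: case_prod_beta)
  from integral_continuous_on_param[OF this] show ?thesis by simp
qed

text \<open>Writing \<open>integral {0..y} f\<close> as an integral over the fixed interval \<open>{0..1}\<close> makes its
continuity in \<open>y\<close>, jointly with any parameters in \<open>f\<close>, an instance of continuity of integrals with
parameters.\<close>

lemma integral_unit_scale:
  fixes f :: "real \<Rightarrow> 'b::banach"
  assumes f: "continuous_on {0..y} f" and y: "0 \<le> y"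
  shows "y *\<^sub>R integral {0..1} (\<lambda>z. f (y * z)) = integral {0..y} f"
proof (cases "y = 0")
  case False
  then have y: "y > 0" using y by simp
  have "(f has_integral integral {0..y} f) (cbox 0 y)"
    using integrable_integral[OF integrable_continuous_real[OF f]] by simp
  from has_integral_affinity'[OF this y, of 0] y
  have "((\<lambda>z. f (y * z)) has_integral (integral {0..y} f /\<^sub>R y)) {0..1}" by simp
  then show ?thesis using y by (simp add: integral_unique)
qed simp

lemma norm_unit_integral_le:
  fixes f :: "real \<Rightarrow> 'b::banach"
  assumes f: "continuous_on {0..1} f" and le: "\<And>z. 0 \<le> z \<Longrightarrow> z \<le> 1 \<Longrightarrow> norm (f z) \<le> C"
  shows "norm (integral {0..1} f) \<le> C"
  using integral_bound[of 0 1 f C] f le by auto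

text \<open>This is the estimate behind Bielecki's weighted norm: against the weight \<open>exp (- \<Lambda> t)\<close>, integration
over \<open>{0..t}\<close> has norm at most \<open>1 / \<Lambda>\<close>, however long the interval is.\<close>

lemma norm_exp_weighted_integral_le:
  fixes g :: "real \<Rightarrow> 'a::banach"
  assumes g: "continuous_on {0..t} g" and t: "0 \<le> t" and \<Lambda>: "0 < \<Lambda>" and D: "0 \<le> D"
    and le: "\<And>u. 0 \<le> u \<Longrightarrow> u \<le> t \<Longrightarrow> norm (g u) \<le> D * exp (\<Lambda> * u)"
  shows "norm (exp (- \<Lambda> * t) *\<^sub>R integral {0..t} g) \<le> D / \<Lambda>"
proof -
  have "((\<lambda>u. D * exp (\<Lambda> * u)) has_integral (D / \<Lambda> * exp (\<Lambda> * t) - D / \<Lambda> * exp (\<Lambda> * 0))) {0..t}"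
    using \<Lambda> by (intro fundamental_theorem_of_calculus[OF t])
      (auto intro!: derivative_eq_intros simp: has_real_derivative_iff_has_vector_derivative[symmetric])
  note I = integral_unique[OF this] and int = has_integral_integrable[OF this]
  have "norm (integral {0..t} g) \<le> integral {0..t} (\<lambda>u. D * exp (\<Lambda> * u))"
    using le by (intro integral_norm_bound_integral integrable_continuous_real g int) auto
  also have "\<dots> \<le> D / \<Lambda> * exp (\<Lambda> * t)" using D \<Lambda> unfolding I by simp
  finally have "exp (- \<Lambda> * t) * norm (integral {0..t} g) \<le> exp (- \<Lambda> * t) * (D / \<Lambda> * exp (\<Lambda> * t))"
    by (intro mult_left_mono) auto
  also have "\<dots> = D / \<Lambda>" by (simp add: exp_minus)
  finally show ?thesis by simp
qed

text \<open>For a globally Lipschitz right hand side the Picard operator is a contraction of the weighted space on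
the whole half-line at once, once the weight beats the Lipschitz constant. The condition \<open>zero\<close>
keeps the weighted solution bounded.\<close>

lemma global_lipschitz_ode:
  fixes f :: "real \<Rightarrow> 'p::metric_space \<Rightarrow> 'a::banach \<Rightarrow> 'a"
  assumes cont: "continuous_on UNIV (\<lambda>q. f (fst q) (fst (snd q)) (snd (snd q)))"
    and lip: "\<And>t p x y. norm (f t p x - f t p y) \<le> K * norm (x - y)" and K: "0 < K"
    and zero: "\<And>t p. f t p 0 = 0"
    and x0: "continuous_on UNIV x0" and C: "\<And>p. norm (x0 p) \<le> C"
  shows "\<exists>X. continuous_on UNIV (\<lambda>q. X (fst q) (snd q)) \<and> (\<forall>p. X 0 p = x0 p) \<and>
    (\<forall>p. \<forall>t\<ge>0. ((\<lambda>t. X t p) has_vector_derivative f t p (X t p)) (at t within {0..}))"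
proof -
  \<comment> \<open>This weight makes the contraction constant one half.\<close>
  define \<Lambda> where "\<Lambda> = 2 * K"
  have \<Lambda>: "0 < \<Lambda>" "0 \<le> \<Lambda>" using K by (auto simp: \<Lambda>_def)
  define T where "T t = max t (0::real)" for t
  have T0: "0 \<le> T t" for t by (simp add: T_def)
  have T_cont [continuous_intros]: "continuous_on S (\<lambda>q. T (g q))" if "continuous_on S g"
    for S and g :: "'c::topological_space \<Rightarrow> real"
    unfolding T_def by (intro continuous_intros that)
  define G where "G \<xi> p u = f u p (exp (\<Lambda> * u) *\<^sub>R \<xi> (u, p))" for \<xi> :: "real \<times> 'p \<Rightarrow> 'a" and p u
  have contG: "continuous_on S (\<lambda>q. G \<xi> (a q) (b q))"
    if "continuous_on UNIV \<xi>" "continuous_on S a" "continuous_on S b"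
    for S and a :: "'c::topological_space \<Rightarrow> 'p" and b \<xi>
  proof -
    have 1: "continuous_on S (\<lambda>q. \<xi> (b q, a q))"
      by (rule continuous_on_compose2[OF that(1)]) (auto intro!: continuous_intros that)
    have "continuous_on S (\<lambda>q. (b q, a q, exp (\<Lambda> * b q) *\<^sub>R \<xi> (b q, a q)))"
      by (intro continuous_intros that 1)
    from continuous_on_compose2[OF cont this] show ?thesis by (simp add: G_def)
  qed
  define \<Phi> where "\<Phi> \<xi> q = exp (- \<Lambda> * T (fst q)) *\<^sub>R
      (x0 (snd q) + T (fst q) *\<^sub>R integral {0..1} (\<lambda>z. G \<xi> (snd q) (T (fst q) * z)))" for \<xi> q
  have \<Phi>_eq: "\<Phi> \<xi> q = exp (- \<Lambda> * T (fst q)) *\<^sub>R x0 (snd q) +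
      exp (- \<Lambda> * T (fst q)) *\<^sub>R integral {0..T (fst q)} (G \<xi> (snd q))"
    if "continuous_on UNIV \<xi>" for \<xi> q
    unfolding \<Phi>_def scaleR_add_right
    by (subst integral_unit_scale) (auto intro!: contG that T0 continuous_intros)
  define B where "B = 2 * C"
  have C0: "0 \<le> C" using C[of undefined] norm_ge_zero order_trans by blast
  have G_lip: "norm (G \<xi> p u - G \<eta> p u) \<le> K * d * exp (\<Lambda> * u)"
    if "norm (\<xi> (u, p) - \<eta> (u, p)) \<le> d" for \<xi> \<eta> p u d
  proof -
    have "norm (G \<xi> p u - G \<eta> p u) \<le> K * norm (exp (\<Lambda> * u) *\<^sub>R (\<xi> (u, p) - \<eta> (u, p)))"
      unfolding G_def using lip by (simp add: scaleR_diff_right)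
    also have "\<dots> \<le> K * (exp (\<Lambda> * u) * d)" using that K by (intro mult_left_mono) auto
    finally show ?thesis by (simp add: mult_ac)
  qed
  \<comment> \<open>\<open>\<xi>\<close> stands for the solution divided by \<open>exp (\<Lambda> t)\<close>.\<close>
  have "\<exists>\<xi>. continuous_on UNIV \<xi> \<and> (\<forall>q. norm (\<xi> q) \<le> B) \<and> \<Phi> \<xi> = \<xi>"
  proof (rule bounded_continuous_fixpoint[where q = "1/2"])
    fix \<xi> :: "real \<times> 'p \<Rightarrow> 'a" assume \<xi>: "continuous_on UNIV \<xi>" and b: "\<And>q. norm (\<xi> q) \<le> B"
    have 1: "continuous_on UNIV (\<lambda>q. integral {0..1} (\<lambda>z. G \<xi> (snd q) (T (fst q) * z)))"
      by (rule continuous_on_unit_integral) (intro contG \<xi> continuous_intros)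
    have 2: "continuous_on UNIV (\<lambda>q::real \<times> 'p. x0 (snd q))"
      by (rule continuous_on_compose2[OF x0]) (auto intro!: continuous_intros)
    show "continuous_on UNIV (\<Phi> \<xi>)"
      unfolding \<Phi>_def by (intro continuous_intros 1 2)
    fix q
    have "norm (exp (- \<Lambda> * T (fst q)) *\<^sub>R integral {0..T (fst q)} (G \<xi> (snd q))) \<le> K * B / \<Lambda>"
    proof (rule norm_exp_weighted_integral_le)
      show "0 \<le> K * B" using K C0 by (simp add: B_def)
      show "norm (G \<xi> (snd q) u) \<le> K * B * exp (\<Lambda> * u)" for u
        using G_lip[of \<xi> u "snd q" "\<lambda>_. 0" B] b by (simp add: G_def zero)
    qed (auto intro!: contG \<xi> T0 \<Lambda> continuous_intros)
    moreover have "norm (exp (- \<Lambda> * T (fst q)) *\<^sub>R x0 (snd q)) \<le> C"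
    proof -
      have "exp (- \<Lambda> * T (fst q)) \<le> 1" using \<Lambda> T0[of "fst q"] by simp
      then have "exp (- \<Lambda> * T (fst q)) * norm (x0 (snd q)) \<le> 1 * C"
        by (intro mult_mono C) auto
      then show ?thesis by simp
    qed
    ultimately show "norm (\<Phi> \<xi> q) \<le> B"
      unfolding \<Phi>_eq[OF \<xi>] using K by (intro norm_triangle_le) (simp add: B_def \<Lambda>_def)
  next
    fix \<xi> \<eta> :: "real \<times> 'p \<Rightarrow> 'a" and d q
    assume \<xi>: "continuous_on UNIV \<xi>" and \<eta>: "continuous_on UNIV \<eta>" and d: "\<And>q. norm (\<xi> q - \<eta> q) \<le> d"
    have d0: "0 \<le> d" using d norm_ge_zero order_trans by blast
    have "\<Phi> \<xi> q - \<Phi> \<eta> q = exp (- \<Lambda> * T (fst q)) *\<^sub>R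
        integral {0..T (fst q)} (\<lambda>u. G \<xi> (snd q) u - G \<eta> (snd q) u)"
      unfolding \<Phi>_eq[OF \<xi>] \<Phi>_eq[OF \<eta>]
      by (subst Henstock_Kurzweil_Integration.integral_diff)
         (auto intro!: integrable_continuous_real contG \<xi> \<eta> continuous_intros simp: scaleR_diff_right)
    also have "norm \<dots> \<le> K * d / \<Lambda>"
      using K d0 G_lip d
      by (intro norm_exp_weighted_integral_le) (auto intro!: contG \<xi> \<eta> T0 \<Lambda> continuous_intros)
    finally show "norm (\<Phi> \<xi> q - \<Phi> \<eta> q) \<le> 1/2 * d" using K by (simp add: \<Lambda>_def)
  qed (use C0 in \<open>auto simp: B_def\<close>)
  then obtain \<xi> where \<xi>: "continuous_on UNIV \<xi>" and fp: "\<Phi> \<xi> = \<xi>" by blast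
  define X where "X t p = exp (\<Lambda> * t) *\<^sub>R \<xi> (t, p)" for t p
  have X_int: "X t p = x0 p + integral {0..t} (\<lambda>u. f u p (X u p))" if "0 \<le> t" for t p
  proof -
    have "X t p = exp (\<Lambda> * t) *\<^sub>R \<Phi> \<xi> (t, p)" using fp by (simp add: X_def)
    also have "\<dots> = x0 p + integral {0..t} (G \<xi> p)"
      using that unfolding \<Phi>_eq[OF \<xi>] T_def by (simp add: scaleR_add_right exp_minus)
    finally show ?thesis by (simp add: G_def[abs_def] X_def)
  qed
  show ?thesis
  proof (intro exI[of _ X] conjI allI impI)
    have "continuous_on UNIV (\<lambda>q. exp (\<Lambda> * fst q) *\<^sub>R \<xi> (fst q, snd q))"
      using \<xi> by (auto intro!: continuous_intros)
    then show "continuous_on UNIV (\<lambda>q. X (fst q) (snd q))" by (simp add: X_def)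
    show "X 0 p = x0 p" for p using X_int[of 0 p] by simp
    fix p and t :: real assume t: "0 \<le> t"
    have "continuous_on {0..t+1} (\<lambda>u. f u p (X u p))"
      using contG[OF \<xi>, of "{0..t+1}" "\<lambda>_. p" "\<lambda>u. u"] by (simp add: G_def X_def continuous_intros)
    from integral_has_vector_derivative[OF this, of t] t
    have "((\<lambda>u. x0 p + integral {0..u} (\<lambda>u. f u p (X u p))) has_vector_derivative f t p (X t p))
        (at t within {0..t+1})"
      by (auto intro!: derivative_eq_intros)
    then have "((\<lambda>t. X t p) has_vector_derivative f t p (X t p)) (at t within {0..t+1})"
      by (rule has_vector_derivative_transform[rotated 2]) (use t X_int in auto)
    moreover have "at t within {0..t+1} = at t within {0..}"
      by (rule at_within_nhd[of _ "{..<t+1}"]) auto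
    ultimately show "((\<lambda>t. X t p) has_vector_derivative f t p (X t p)) (at t within {0..})" by simp
  qed
qed

section \<open>Solutions leaving the saddle\<close>

text \<open>\<open>T = tanh\<close> is the boundary value problem in the variable \<open>ln (tan t)\<close>. Other coefficients occur because
time shifts of it, and the limit \<open>T = - 1\<close> of these shifts, are treated together.\<close>

definition oscillator :: "real \<Rightarrow> (real \<Rightarrow> real) \<Rightarrow> (real \<Rightarrow> real) \<Rightarrow> (real \<Rightarrow> real) \<Rightarrow> bool" where
  "oscillator m T h v \<longleftrightarrow> (\<forall>s. (h has_real_derivative v s) (at s) \<and>
     (v has_real_derivative T s * ((m - 1) * v s + m / 2 * sin (2 * h s))) (at s))"

lemma sin_defect_lipschitz:
  fixes x y r :: real
  assumes "\<bar>x\<bar> \<le> r" "\<bar>y\<bar> \<le> r"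
  shows "\<bar>(sin (2 * x) / 2 - x) - (sin (2 * y) / 2 - y)\<bar> \<le> 2 * r\<^sup>2 * \<bar>x - y\<bar>"
proof -
  have "norm ((sin (2 * x) / 2 - x) - (sin (2 * y) / 2 - y)) \<le> 2 * r\<^sup>2 * norm (x - y)"
  proof (rule field_differentiable_bound[where S = "{-r..r}" and f' = "\<lambda>x. cos (2 * x) - 1"])
    fix z :: real assume z: "z \<in> {-r..r}"
    show "((\<lambda>x. sin (2 * x) / 2 - x) has_field_derivative cos (2 * z) - 1) (at z within {-r..r})"
      by (auto intro!: derivative_eq_intros)
    have "\<bar>sin z\<bar> \<le> r" using abs_sin_x_le_abs_x[of z] z by auto
    then have "(sin z)\<^sup>2 \<le> r\<^sup>2" using abs_le_square_iff[of "sin z" r] by auto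
    then show "norm (cos (2 * z) - 1) \<le> 2 * r\<^sup>2" by (simp add: cos_double_sin)
  qed (use assms in auto)
  then show ?thesis by simp
qed

text \<open>Put \<open>y = exp s\<close> and \<open>h + pi / 2 = y a\<close>, where \<open>T s = -1 + 2 e y\<^sup>2 / (1 + e y\<^sup>2)\<close>. The part of the
oscillator equation linear at the saddle \<open>h = - pi / 2\<close> at \<open>T = -1\<close> is \<open>(D - 1) (D + m)\<close> with \<open>D = d/ds\<close>. With
\<open>(D - 1) (y a) = y\<^sup>2 c\<close> the equation becomes \<open>a' = c\<close>, \<open>y c' + (m + 2) c = slope_source m y e a c\<close>,
derivatives with respect to \<open>y\<close>. At \<open>y = 0\<close> the convention \<open>x / 0 = 0\<close> gives the
quotient its limit value.\<close>

definition slope_source :: "real \<Rightarrow> real \<Rightarrow> real \<Rightarrow> real \<Rightarrow> real \<Rightarrow> real" where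
  "slope_source M y e a c = M * ((sin (2 * (y * a)) / 2 - y * a) / y\<^sup>2)
     + 2 * e / (1 + e * y\<^sup>2) * ((M - 1) * (y * a + y\<^sup>2 * c) - M / 2 * sin (2 * (y * a)))"

text \<open>The factor \<open>y\<close> on the right makes the singular integral equation contractive near \<open>y = 0\<close>. It
comes from the cubic vanishing of \<open>sin (2 x) / 2 - x\<close>, which compensates the division by \<open>y\<^sup>2\<close>.\<close>

lemma slope_source_lipschitz:
  assumes M: "1 \<le> M" and y: "0 \<le> y" "y \<le> 1" and e: "0 \<le> e" "e \<le> 1"
    and a: "\<bar>a\<bar> \<le> 2" "\<bar>a'\<bar> \<le> 2" and d: "\<bar>a - a'\<bar> \<le> d" "\<bar>c - c'\<bar> \<le> d"
  shows "\<bar>slope_source M y e a c - slope_source M y e a' c'\<bar> \<le> 14 * M * y * d"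
proof (cases "y = 0")
  case True
  then show ?thesis by (simp add: slope_source_def)
next
  case False
  with y have y0: "0 < y" by simp
  have d0: "0 \<le> d" using d by linarith
  let ?\<phi> = "\<lambda>x. sin (2 * x) / 2 - x"
  have 1: "\<bar>?\<phi> (y * a) - ?\<phi> (y * a')\<bar> \<le> 8 * y * d * y\<^sup>2"
  proof -
    have "\<bar>?\<phi> (y * a) - ?\<phi> (y * a')\<bar> \<le> 2 * (2 * y)\<^sup>2 * \<bar>y * a - y * a'\<bar>"
      using a y mult_left_mono[OF a(1) y(1)] mult_left_mono[OF a(2) y(1)]
      by (intro sin_defect_lipschitz) (auto simp: abs_mult)
    also have "\<bar>y * a - y * a'\<bar> = y * \<bar>a - a'\<bar>"
      using y by (simp add: right_diff_distrib[symmetric] abs_mult)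
    also have "2 * (2 * y)\<^sup>2 * (y * \<bar>a - a'\<bar>) \<le> 2 * (2 * y)\<^sup>2 * (y * d)"
      using y d by (intro mult_left_mono) auto
    finally show ?thesis by (simp add: power2_eq_square mult_ac)
  qed
  have 2: "\<bar>M * (?\<phi> (y * a) / y\<^sup>2) - M * (?\<phi> (y * a') / y\<^sup>2)\<bar> \<le> 8 * M * y * d"
  proof -
    have "\<bar>M * (?\<phi> (y * a) / y\<^sup>2) - M * (?\<phi> (y * a') / y\<^sup>2)\<bar> = M * (\<bar>?\<phi> (y * a) - ?\<phi> (y * a')\<bar> / y\<^sup>2)"
      using M y0 by (simp add: abs_mult diff_divide_distrib[symmetric] right_diff_distrib[symmetric])
    also have "\<dots> \<le> M * (8 * y * d)"
      using 1 M y0 by (intro mult_left_mono) (auto simp: divide_le_eq)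
    finally show ?thesis by (simp add: mult_ac)
  qed
  define w where "w = 2 * e / (1 + e * y\<^sup>2)"
  have ey: "0 \<le> e * y\<^sup>2" using e by simp
  have "0 < 1 + e * y\<^sup>2" by (rule add_pos_nonneg[OF zero_less_one ey])
  moreover have "2 * e \<le> 2 * (1 + e * y\<^sup>2)"
    by (rule mult_left_mono[OF add_increasing2[OF ey e(2)]]) simp
  ultimately have w: "0 \<le> w" "w \<le> 2" using e unfolding w_def by (simp, simp only: divide_le_eq if_True)
  define P where "P a c = (M - 1) * (y * a + y\<^sup>2 * c) - M / 2 * sin (2 * (y * a))" for a c
  have 3: "\<bar>P a c - P a' c'\<bar> \<le> 3 * M * y * d"
  proof -
    have ya: "\<bar>y * a - y * a'\<bar> \<le> y * d"
      using y d by (simp add: right_diff_distrib[symmetric] abs_mult mult_left_mono)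
    have yc: "\<bar>y\<^sup>2 * c - y\<^sup>2 * c'\<bar> \<le> y * d"
    proof -
      have "\<bar>y\<^sup>2 * c - y\<^sup>2 * c'\<bar> = y * (y * \<bar>c - c'\<bar>)"
        using y by (simp add: right_diff_distrib[symmetric] abs_mult power2_eq_square)
      also have "\<dots> \<le> y * (1 * d)" using y d by (intro mult_left_mono mult_mono) auto
      finally show ?thesis by simp
    qed
    have s: "\<bar>sin (2 * (y * a)) - sin (2 * (y * a'))\<bar> \<le> 2 * (y * d)"
    proof -
      have "norm (sin (2 * (y * a)) - sin (2 * (y * a'))) \<le> 1 * norm (2 * (y * a) - 2 * (y * a'))"
        by (rule field_differentiable_bound[where S = UNIV and f' = cos])
          (auto intro!: derivative_eq_intros)
      then show ?thesis using ya by simp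
    qed
    have "\<bar>P a c - P a' c'\<bar> = \<bar>(M - 1) * ((y * a - y * a') + (y\<^sup>2 * c - y\<^sup>2 * c'))
        - M / 2 * (sin (2 * (y * a)) - sin (2 * (y * a')))\<bar>"
      by (simp add: P_def algebra_simps)
    also have "\<dots> \<le> (M - 1) * \<bar>(y * a - y * a') + (y\<^sup>2 * c - y\<^sup>2 * c')\<bar>
        + M / 2 * \<bar>sin (2 * (y * a)) - sin (2 * (y * a'))\<bar>"
      using M by (intro order_trans[OF abs_triangle_ineq4]) (simp add: abs_mult)
    also have "\<dots> \<le> (M - 1) * (2 * (y * d)) + M / 2 * (2 * (y * d))"
      using M ya yc s by (intro add_mono mult_left_mono) auto
    also have "\<dots> \<le> 3 * M * y * d" using y d0 by (simp add: algebra_simps)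
    finally show ?thesis .
  qed
  have 4: "\<bar>w * P a c - w * P a' c'\<bar> \<le> 2 * (3 * M * y * d)"
    using w 3 unfolding right_diff_distrib[symmetric] abs_mult by (intro mult_mono) auto
  have "\<bar>slope_source M y e a c - slope_source M y e a' c'\<bar>
      \<le> \<bar>M * (?\<phi> (y * a) / y\<^sup>2) - M * (?\<phi> (y * a') / y\<^sup>2)\<bar> + \<bar>w * P a c - w * P a' c'\<bar>"
    unfolding slope_source_def P_def w_def by (rule abs_diff_triangle_ineq)
  then show ?thesis using 2 4 by (simp add: mult.assoc)
qed

lemma slope_source_continuous:
  fixes S :: "'c::metric_space set"
  assumes E: "continuous_on UNIV E" "\<And>e. 0 \<le> E e"
    and c: "continuous_on S y" "continuous_on S e" "continuous_on S a" "continuous_on S c"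
  shows "continuous_on S (\<lambda>q. slope_source M (y q) (E (e q)) (a q) (c q))"
proof -
  let ?\<psi> = "\<lambda>p::real \<times> real. (sin (2 * (fst p * snd p)) / 2 - fst p * snd p) / (fst p)\<^sup>2"
  have bound: "\<bar>?\<psi> p\<bar> \<le> 2 * \<bar>fst p\<bar> * \<bar>snd p\<bar> ^ 3" for p
  proof (cases "fst p = 0")
    case False
    have "\<bar>sin (2 * (fst p * snd p)) / 2 - fst p * snd p\<bar> \<le> 2 * \<bar>fst p * snd p\<bar>\<^sup>2 * \<bar>fst p * snd p\<bar>"
      using sin_defect_lipschitz[of "fst p * snd p" "\<bar>fst p * snd p\<bar>" 0] by simp
    also have "\<dots> = (2 * \<bar>fst p\<bar> * \<bar>snd p\<bar> ^ 3) * (fst p)\<^sup>2"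
      by (simp add: abs_mult power2_eq_square power3_eq_cube mult_ac)
    finally show ?thesis using False by (simp add: divide_le_eq)
  qed simp
  have "isCont ?\<psi> p" for p
  proof (cases "fst p = 0")
    case True
    have "((\<lambda>p. 2 * \<bar>fst p\<bar> * \<bar>snd p\<bar> ^ 3) \<longlongrightarrow> 2 * \<bar>fst p\<bar> * \<bar>snd p\<bar> ^ 3) (at p)"
      by (intro tendsto_intros)
    then have "((\<lambda>p. 2 * \<bar>fst p\<bar> * \<bar>snd p\<bar> ^ 3) \<longlongrightarrow> 0) (at p)" using True by simp
    then have "(?\<psi> \<longlongrightarrow> 0) (at p)"
      by (rule Lim_null_comparison[rotated]) (use bound in auto)
    then show ?thesis using True by (simp add: isCont_def)
  next
    case False
    then show ?thesis by (intro continuous_intros) auto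
  qed
  then have "continuous_on UNIV ?\<psi>" by (simp add: continuous_at_imp_continuous_on)
  from continuous_on_compose2[OF this continuous_on_Pair[OF c(1,3)]]
  have 1: "continuous_on S (\<lambda>q. (sin (2 * (y q * a q)) / 2 - y q * a q) / (y q)\<^sup>2)" by simp
  have 2: "continuous_on S (\<lambda>q. E (e q))" by (rule continuous_on_compose2[OF E(1) c(2)]) auto
  have 3: "1 + E (e q) * (y q)\<^sup>2 \<noteq> 0" for q
  proof -
    have "0 \<le> E (e q) * (y q)\<^sup>2" using E(2) by simp
    then show ?thesis by linarith
  qed
  have 4: "continuous_on S (\<lambda>q. 2 * E (e q) / (1 + E (e q) * (y q)\<^sup>2) *
      ((M - 1) * (y q * a q + (y q)\<^sup>2 * c q) - M / 2 * sin (2 * (y q * a q))))"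
    by (intro continuous_intros 2 c) (use 3 in auto)
  show ?thesis unfolding slope_source_def
    by (rule continuous_on_add[OF continuous_on_mult[OF continuous_on_const 1] 4])
qed

text \<open>The singular equation for \<open>c\<close> has the integral form
\<open>c(y) = integral {0..1} (\<lambda>z. z ^ (m + 1) * slope_source m (y z) ...)\<close> with \<open>a(y) = 1 + integral {0..y} c\<close>,
which is regular at \<open>y = 0\<close>. The value \<open>a(0) = 1\<close> fixes the time translation along the
unstable manifold.\<close>

lemma singular_start:
  fixes m :: nat and E :: "real \<Rightarrow> real"
  assumes m: "1 \<le> m" and E: "continuous_on UNIV E" "\<And>e. 0 \<le> E e" "\<And>e. E e \<le> 1"
  shows "\<exists>y0>0. \<exists>a c :: real \<Rightarrow> real \<Rightarrow> real.
    continuous_on ({0..y0} \<times> UNIV) (\<lambda>q. a (fst q) (snd q)) \<and>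
    continuous_on ({0..y0} \<times> UNIV) (\<lambda>q. c (fst q) (snd q)) \<and>
    (\<forall>y\<in>{0..y0}. \<forall>e. \<bar>a y e - 1\<bar> \<le> y \<and> \<bar>c y e\<bar> \<le> 1) \<and>
    (\<forall>y\<in>{0<..<y0}. \<forall>e. ((\<lambda>y. a y e) has_real_derivative c y e) (at y) \<and>
      ((\<lambda>y. c y e) has_real_derivative
         (slope_source m y (E e) (a y e) (c y e) - real (m + 2) * c y e) / y) (at y))"
proof -
  \<comment> \<open>With the constant \<open>14 * m * y\<close> of \<open>slope_source_lipschitz\<close> this bounds the source by 1 on
    \<open>\<bar>a\<bar> \<le> 2\<close>, \<open>\<bar>c\<bar> \<le> 1\<close> and makes it one half Lipschitz.\<close>
  define y0 where "y0 = 1 / (28 * real m)"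
  have y0: "0 < y0" "y0 \<le> 1" and y0m: "28 * real m * y0 = 1"
    using m by (auto simp: y0_def)
  define Y where "Y y = max 0 (min y0 y)" for y
  have Y: "0 \<le> Y y" "Y y \<le> y0" for y using y0 by (auto simp: Y_def)
  have Y_cont [continuous_intros]: "continuous_on S (\<lambda>q. Y (g q))" if "continuous_on S g"
    for S and g :: "'c::metric_space \<Rightarrow> real"
    unfolding Y_def by (intro continuous_intros that)
  define A where "A f y e = 1 + y * integral {0..1} (\<lambda>z. f (y * z, e))"
    for f :: "real \<times> real \<Rightarrow> real" and y e
  have comp: "continuous_on S (\<lambda>q. f (g q, h q))"
    if "continuous_on UNIV f" "continuous_on S g" "continuous_on S h"
    for S and g h :: "'c::metric_space \<Rightarrow> real" and f :: "real \<times> real \<Rightarrow> real"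
    by (rule continuous_on_compose2[OF that(1)]) (auto intro!: continuous_intros that)
  have A_cont0: "continuous_on UNIV (\<lambda>q. A f (fst q) (snd q))" if f: "continuous_on UNIV f" for f
    unfolding A_def by (intro continuous_intros continuous_on_unit_integral comp f)
  have A_cont: "continuous_on S (\<lambda>q. A f (g q) (h q))"
    if "continuous_on UNIV f" "continuous_on S g" "continuous_on S h"
    for S and g h :: "'c::metric_space \<Rightarrow> real" and f
    using continuous_on_compose2[OF A_cont0[OF that(1)] continuous_on_Pair[OF that(2,3)]] by simp
  have A_bound: "\<bar>A f y e - A g y e\<bar> \<le> y * d"
    if "continuous_on UNIV f" "continuous_on UNIV g" "\<And>q. \<bar>f q - g q\<bar> \<le> d" "0 \<le> y" for f g y e d
  proof -
    have "A f y e - A g y e = y * integral {0..1} (\<lambda>z. f (y * z, e) - g (y * z, e))"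
      unfolding A_def
      by (subst Henstock_Kurzweil_Integration.integral_diff)
        (auto intro!: integrable_continuous_real comp that continuous_intros simp: algebra_simps)
    moreover have "norm (integral {0..1} (\<lambda>z. f (y * z, e) - g (y * z, e))) \<le> d"
      by (rule norm_unit_integral_le) (auto intro!: comp that continuous_intros)
    ultimately show ?thesis using that(4) by (simp add: abs_mult mult_left_mono)
  qed
  have A_1: "\<bar>A f y e - 1\<bar> \<le> y" if "continuous_on UNIV f" "\<And>q. \<bar>f q\<bar> \<le> 1" "0 \<le> y" for f y e
    using A_bound[of f "\<lambda>_. 0" 1 y e] that by (auto simp: A_def[of "\<lambda>_. 0"])
  have A_2: "\<bar>A f y e\<bar> \<le> 2" if "continuous_on UNIV f" "\<And>q. \<bar>f q\<bar> \<le> 1" "0 \<le> y" "y \<le> y0" for f y e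
    using A_1[OF that(1-3), of e] that(4) y0 by linarith
  define R where "R f y e = slope_source m y (E e) (A f y e) (f (y, e))" for f y e
  have R_cont: "continuous_on S (\<lambda>q. R f (g q) (h q))"
    if "continuous_on UNIV f" "continuous_on S g" "continuous_on S h"
    for S and g h :: "'c::metric_space \<Rightarrow> real" and f
    unfolding R_def by (intro slope_source_continuous E A_cont comp that)
  have R_lip: "\<bar>R f y e - R g y e\<bar> \<le> 1/2 * d"
    if f: "continuous_on UNIV f" "\<And>q. \<bar>f q\<bar> \<le> 1" and g: "continuous_on UNIV g" "\<And>q. \<bar>g q\<bar> \<le> 1"
      and d: "\<And>q. \<bar>f q - g q\<bar> \<le> d" and y: "0 \<le> y" "y \<le> y0" for f g y e d
  proof -
    have d0: "0 \<le> d" using d[of undefined] by linarith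
    have "y * d \<le> 1 * d" using y y0 d0 by (intro mult_right_mono) auto
    then have "\<bar>A f y e - A g y e\<bar> \<le> d" using A_bound[OF f(1) g(1) d y(1), of e] by linarith
    then have "\<bar>R f y e - R g y e\<bar> \<le> 14 * real m * y * d"
      unfolding R_def using y y0 m E
      by (intro slope_source_lipschitz A_2 f g d) auto
    also have "\<dots> \<le> 14 * real m * y0 * d" using y d0 by (intro mult_right_mono mult_left_mono) auto
    also have "\<dots> = 1/2 * d" using y0m by simp
    finally show ?thesis .
  qed
  have R_1: "\<bar>R f y e\<bar> \<le> 1"
    if f: "continuous_on UNIV f" "\<And>q. \<bar>f q\<bar> \<le> 1" and y: "0 \<le> y" "y \<le> y0" for f y e
  proof -
    have "\<bar>slope_source m y (E e) (A f y e) (f (y, e)) - slope_source m y (E e) 0 0\<bar> \<le> 14 * real m * y * 2"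
      using y y0 m E f(2)[of "(y, e)"] A_2[OF f y, of e]
      by (intro slope_source_lipschitz) auto
    also have "\<dots> \<le> 14 * real m * y0 * 2" using y by (intro mult_right_mono mult_left_mono) auto
    finally show ?thesis using y0m by (simp add: R_def slope_source_def)
  qed
  define \<Phi> where "\<Phi> f q = integral {0..1} (\<lambda>z. z ^ (m + 1) * R f (Y (fst q) * z) (snd q))" for f q
  have Yz: "0 \<le> Y y * z" "Y y * z \<le> y0" if "0 \<le> z" "z \<le> 1" for y z
    using Y[of y] that mult_mono[of "Y y" y0 z 1] y0 by auto
  have \<Phi>_cont: "continuous_on S (\<lambda>z. z ^ (m + 1) * R f (Y y * z) e)" if "continuous_on UNIV f" for S f y e
    by (intro continuous_intros R_cont that)
  have weight: "\<bar>z ^ (m + 1) * x\<bar> \<le> d" if "0 \<le> z" "z \<le> 1" "\<bar>x\<bar> \<le> d" for z x d :: real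
  proof -
    have "z ^ (m + 1) \<le> 1" "0 \<le> z ^ (m + 1)" using that by (auto intro!: power_le_one simp del: power_Suc)
    then have "z ^ (m + 1) * \<bar>x\<bar> \<le> 1 * d" using that by (intro mult_mono) auto
    then show ?thesis using that by (simp add: abs_mult)
  qed
  have "\<exists>f. continuous_on UNIV f \<and> (\<forall>q. norm (f q) \<le> 1) \<and> \<Phi> f = f"
  proof (rule bounded_continuous_fixpoint[where q = "1/2"])
    fix f :: "real \<times> real \<Rightarrow> real" assume f: "continuous_on UNIV f" and f1: "\<And>q. norm (f q) \<le> 1"
    show "continuous_on UNIV (\<Phi> f)"
      unfolding \<Phi>_def by (intro continuous_on_unit_integral continuous_intros R_cont f)
    show "norm (\<Phi> f q) \<le> 1" for q
      unfolding \<Phi>_def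
      by (rule norm_unit_integral_le[OF \<Phi>_cont[OF f]], unfold real_norm_def)
        (intro weight R_1 f f1[unfolded real_norm_def] Yz; assumption)
    fix g d q assume g: "continuous_on UNIV g" and g1: "\<And>q. norm (g q) \<le> 1" and d: "\<And>q. norm (f q - g q) \<le> d"
    have "\<Phi> f q - \<Phi> g q = integral {0..1} (\<lambda>z. z ^ (m + 1) * (R f (Y (fst q) * z) (snd q) - R g (Y (fst q) * z) (snd q)))"
      unfolding \<Phi>_def right_diff_distrib
      by (rule Henstock_Kurzweil_Integration.integral_diff[symmetric])
        (intro integrable_continuous_real \<Phi>_cont f g)+
    also have "norm \<dots> \<le> 1/2 * d"
      by (rule norm_unit_integral_le, intro continuous_intros R_cont f g, unfold real_norm_def)
        (intro weight R_lip f f1[unfolded real_norm_def] g g1[unfolded real_norm_def]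
          d[unfolded real_norm_def] Yz; assumption)
    finally show "norm (\<Phi> f q - \<Phi> g q) \<le> 1/2 * d" .
  qed auto
  then obtain f where f: "continuous_on UNIV f" and f1: "\<And>q. \<bar>f q\<bar> \<le> 1" and fp: "\<Phi> f = f"
    unfolding real_norm_def by blast
  define a where "a y e = A f y e" for y e
  define c where "c y e = f (y, e)" for y e
  have a_eq: "a y e = 1 + integral {0..y} (\<lambda>u. c u e)" if "0 \<le> y" for y e
    unfolding a_def A_def c_def
    using integral_unit_scale[OF comp[OF f continuous_on_id continuous_on_const] that, of e] by simp
  have c_eq: "y ^ (m + 2) * c y e = integral {0..y} (\<lambda>u. u ^ (m + 1) * R f u e)" if "0 \<le> y" "y \<le> y0" for y e
  proof -
    have "c y e = \<Phi> f (y, e)" unfolding fp c_def ..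
    also have "\<dots> = integral {0..1} (\<lambda>z. z ^ (m + 1) * R f (y * z) e)"
      using that by (simp add: \<Phi>_def Y_def)
    finally have "y ^ (m + 2) * c y e = y * (y ^ (m + 1) * integral {0..1} (\<lambda>z. z ^ (m + 1) * R f (y * z) e))"
      by simp
    also have "\<dots> = y *\<^sub>R integral {0..1} (\<lambda>z. (y * z) ^ (m + 1) * R f (y * z) e)"
      unfolding integral_mult_right[symmetric] power_mult_distrib mult.assoc real_scaleR_def ..
    also have "\<dots> = integral {0..y} (\<lambda>u. u ^ (m + 1) * R f u e)"
      by (rule integral_unit_scale) (intro continuous_intros R_cont f that)+
    finally show ?thesis .
  qed
  have int_deriv: "((\<lambda>y. integral {0..y} g) has_real_derivative g y) (at y)"
    if "continuous_on UNIV g" "0 < y" for g :: "real \<Rightarrow> real" and y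
  proof -
    have "((\<lambda>y. integral {0..y} g) has_real_derivative g y) (at y within {0..y+1})"
      using that by (intro integral_has_real_derivative) (auto intro: continuous_on_subset)
    moreover have "at y within {0..y+1} = at y" using that by (intro at_within_interior) auto
    ultimately show ?thesis by simp
  qed
  show ?thesis
  proof (rule exI[of _ y0], rule conjI[OF y0(1)], rule exI[of _ a], rule exI[of _ c], intro conjI ballI allI)
    show "continuous_on ({0..y0} \<times> UNIV) (\<lambda>q. a (fst q) (snd q))"
      unfolding a_def by (intro A_cont f continuous_intros)
    show "continuous_on ({0..y0} \<times> UNIV) (\<lambda>q. c (fst q) (snd q))"
      unfolding c_def by (intro comp f continuous_intros)
    show "\<bar>a y e - 1\<bar> \<le> y" if "y \<in> {0..y0}" for y e using A_1[OF f f1] that by (auto simp: a_def)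
    show "\<bar>c y e\<bar> \<le> 1" for y e using f1 by (simp add: c_def)
    fix y e assume y: "y \<in> {0<..<y0}"
    have "((\<lambda>y. integral {0..y} (\<lambda>u. c u e)) has_real_derivative c y e) (at y)"
      unfolding c_def
      by (rule int_deriv[OF comp[OF f continuous_on_id continuous_on_const]]) (use y in simp)
    from DERIV_add[OF DERIV_const[of 1] this]
    have "((\<lambda>y. 1 + integral {0..y} (\<lambda>u. c u e)) has_real_derivative c y e) (at y)" by simp
    then show "((\<lambda>y. a y e) has_real_derivative c y e) (at y)"
      by (rule has_field_derivative_transform_within[where d = y]) (use y a_eq in \<open>auto simp: dist_real_def\<close>)
    define I where "I y = integral {0..y} (\<lambda>u. u ^ (m + 1) * R f u e)" for y
    have I: "(I has_real_derivative y ^ (m + 1) * R f y e) (at y)"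
      unfolding I_def[abs_def]
    proof (rule int_deriv)
      show "continuous_on UNIV (\<lambda>u. u ^ (m + 1) * R f u e)"
        by (intro continuous_intros R_cont f)
    qed (use y in simp)
    have I_c: "I x = x ^ (m + 2) * c x e" if "x \<in> {0<..<y0}" for x
    proof -
      have "0 \<le> x" "x \<le> y0" using that by auto
      then show ?thesis unfolding I_def by (rule c_eq[symmetric])
    qed
    define p where "p = y ^ (m + 1)"
    have p: "p \<noteq> 0" "y ^ (m + 2) = p * y" "y \<noteq> 0" using y by (auto simp: p_def)
    have "((\<lambda>y. I y / y ^ (m + 2)) has_real_derivative
        (y ^ (m + 1) * R f y e * y ^ (m + 2) - I y * (real (m + 2) * y ^ (m + 2 - Suc 0)))
        / (y ^ (m + 2) * y ^ (m + 2))) (at y)"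
      by (rule DERIV_divide[OF I DERIV_pow]) (use p(3) in simp)
    moreover have "(y ^ (m + 1) * R f y e * y ^ (m + 2) - I y * (real (m + 2) * y ^ (m + 2 - Suc 0)))
        / (y ^ (m + 2) * y ^ (m + 2)) = (R f y e - real (m + 2) * c y e) / y"
    proof -
      have "(p * r * (p * y) - p * y * d * (k * p)) / ((p * y) * (p * y)) = (r - k * d) / y" for r d k
      proof -
        have "p * r * (p * y) - p * y * d * (k * p) = (p * p * y) * (r - k * d)"
          by (simp add: algebra_simps)
        then show ?thesis using p(1,3) by simp
      qed
      moreover have "m + 2 - Suc 0 = m + 1" by simp
      ultimately show ?thesis
        unfolding I_c[OF y] \<open>m + 2 - Suc 0 = m + 1\<close> p(2) p_def[symmetric] by simp
    qed
    ultimately have "((\<lambda>y. I y / y ^ (m + 2)) has_real_derivative (R f y e - real (m + 2) * c y e) / y) (at y)"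
      by (simp only:)
    moreover have "I x / x ^ (m + 2) = c x e" if "x \<in> {0<..<y0}" for x
      unfolding I_c[OF that] using that by simp
    ultimately have "((\<lambda>y. c y e) has_real_derivative (R f y e - real (m + 2) * c y e) / y) (at y)"
      by (rule has_field_derivative_transform_within_open[OF _ open_greaterThanLessThan y])
    then show "((\<lambda>y. c y e) has_real_derivative
         (slope_source m y (E e) (a y e) (c y e) - real (m + 2) * c y e) / y) (at y)"
      by (simp add: R_def a_def c_def add.commute)
  qed
qed

lemma DERIV_glue_at:
  fixes f g :: "real \<Rightarrow> real"
  assumes f: "(f has_real_derivative D) (at a)" and g: "(g has_real_derivative D) (at a within {a..})"
    and eq: "f a = g a"
  shows "((\<lambda>s. if s \<le> a then f s else g s) has_real_derivative D) (at a)"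
proof -
  let ?k = "\<lambda>s. if s \<le> a then f s else g s"
  have "(?k has_real_derivative D) (at a within {..a})"
    by (rule has_field_derivative_transform_within[OF DERIV_subset[OF f subset_UNIV], of 1]) auto
  then have "(?k has_real_derivative D) (at_left a)" by (rule DERIV_subset) auto
  moreover have "(?k has_real_derivative D) (at a within {a..})"
    by (rule has_field_derivative_transform_within[OF g, of 1]) (auto simp: eq)
  then have "(?k has_real_derivative D) (at_right a)" by (rule DERIV_subset) auto
  ultimately show ?thesis
    unfolding has_field_derivative_iff by (rule filterlim_split_at)
qed

lemma regular_continuation:
  fixes m :: real and T :: "real \<Rightarrow> real \<Rightarrow> real"
  assumes m: "1 \<le> m" and T: "continuous_on UNIV (\<lambda>q. T (fst q) (snd q))" "\<And>s e. \<bar>T s e\<bar> \<le> 1"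
    and h0: "continuous_on UNIV h0" "\<And>e. \<bar>h0 e\<bar> \<le> C" and v0: "continuous_on UNIV v0" "\<And>e. \<bar>v0 e\<bar> \<le> C"
  shows "\<exists>h v. continuous_on UNIV (\<lambda>q. h (fst q) (snd q)) \<and> continuous_on UNIV (\<lambda>q. v (fst q) (snd q)) \<and>
    (\<forall>e. h s1 e = h0 e \<and> v s1 e = v0 e) \<and>
    (\<forall>e. \<forall>s\<ge>s1. ((\<lambda>s. h s e) has_real_derivative v s e) (at s within {s1..}) \<and>
       ((\<lambda>s. v s e) has_real_derivative T s e * ((m - 1) * v s e + m / 2 * sin (2 * h s e))) (at s within {s1..}))"
proof -
  define f where "f t e x = (snd x, T (s1 + t) e * ((m - 1) * snd x + m / 2 * sin (2 * fst x)))"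
    for t e :: real and x :: "real \<times> real"
  have "\<exists>X. continuous_on UNIV (\<lambda>q. X (fst q) (snd q)) \<and> (\<forall>p. X 0 p = (h0 p, v0 p)) \<and>
    (\<forall>p. \<forall>t\<ge>0. ((\<lambda>t. X t p) has_vector_derivative f t p (X t p)) (at t within {0..}))"
  proof (rule global_lipschitz_ode[where K = "2 * m" and C = "2 * C"])
    have "continuous_on UNIV (\<lambda>q::real \<times> real \<times> real \<times> real. T (s1 + fst q) (fst (snd q)))"
      using continuous_on_compose2[OF T(1), of UNIV "\<lambda>q. (s1 + fst q, fst (snd q))"]
      by (simp add: continuous_intros)
    then show "continuous_on UNIV (\<lambda>q. f (fst q) (fst (snd q)) (snd (snd q)))"
      unfolding f_def by (intro continuous_intros)
    show "norm (f t p x - f t p y) \<le> 2 * m * norm (x - y)" for t p x y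
    proof -
      have fs: "\<bar>fst x - fst y\<bar> \<le> norm (x - y)" "\<bar>snd x - snd y\<bar> \<le> norm (x - y)"
        using norm_fst_le[of "fst x - fst y" "snd x - snd y"]
          norm_snd_le[of "snd x - snd y" "fst x - fst y"] by (auto simp: minus_prod_def)
      have s: "\<bar>sin (2 * fst x) - sin (2 * fst y)\<bar> \<le> 2 * norm (x - y)"
      proof -
        have "norm (sin (2 * fst x) - sin (2 * fst y)) \<le> 1 * norm (2 * fst x - 2 * fst y)"
          by (rule field_differentiable_bound[where S = UNIV and f' = cos])
            (auto intro!: derivative_eq_intros)
        then show ?thesis using fs by simp
      qed
      have "\<bar>(m - 1) * (snd x - snd y) + m / 2 * (sin (2 * fst x) - sin (2 * fst y))\<bar>
          \<le> (m - 1) * \<bar>snd x - snd y\<bar> + m / 2 * \<bar>sin (2 * fst x) - sin (2 * fst y)\<bar>"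
        using m by (intro order_trans[OF abs_triangle_ineq]) (simp add: abs_mult)
      also have "\<dots> \<le> (m - 1) * norm (x - y) + m / 2 * (2 * norm (x - y))"
        using m fs s by (intro add_mono mult_left_mono) auto
      also have "\<dots> = (2 * m - 1) * norm (x - y)" by (simp add: algebra_simps)
      finally have "\<bar>T (s1 + t) p\<bar> * \<bar>(m - 1) * (snd x - snd y) + m / 2 * (sin (2 * fst x) - sin (2 * fst y))\<bar>
          \<le> 1 * ((2 * m - 1) * norm (x - y))"
        using T(2) by (intro mult_mono) auto
      moreover have "f t p x - f t p y = (snd x - snd y,
          T (s1 + t) p * ((m - 1) * (snd x - snd y) + m / 2 * (sin (2 * fst x) - sin (2 * fst y))))"
        by (simp add: f_def algebra_simps)
      ultimately have "norm (f t p x - f t p y) \<le> norm (x - y) + (2 * m - 1) * norm (x - y)"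
        using fs by (auto intro!: order_trans[OF norm_Pair_le] add_mono simp: abs_mult)
      then show ?thesis by (simp add: algebra_simps)
    qed
    show "norm (h0 p, v0 p) \<le> 2 * C" for p
      using norm_Pair_le[of "h0 p" "v0 p"] h0(2)[of p] v0(2)[of p] by simp
  qed (use m in \<open>auto simp: f_def zero_prod_def intro!: continuous_intros h0 v0\<close>)
  then obtain X where X: "continuous_on UNIV (\<lambda>q. X (fst q) (snd q))" "\<And>p. X 0 p = (h0 p, v0 p)"
    and X': "\<And>p t. 0 \<le> t \<Longrightarrow> ((\<lambda>t. X t p) has_vector_derivative f t p (X t p)) (at t within {0..})" by blast
  have shift: "((\<lambda>s. g (s - s1)) has_real_derivative D) (at s within {s1..})"
    if "(g has_real_derivative D) (at (s - s1) within {0..})" for g D s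
  proof -
    have "(g has_real_derivative D) (at (s - s1) within (\<lambda>s. s - s1) ` {s1..})"
      by (rule DERIV_subset[OF that]) auto
    moreover have "((\<lambda>s. s - s1) has_real_derivative 1) (at s within {s1..})"
      by (auto intro!: derivative_eq_intros)
    ultimately have "(g \<circ> (\<lambda>s. s - s1) has_real_derivative D * 1) (at s within {s1..})"
      by (rule DERIV_image_chain)
    then show ?thesis by (simp add: o_def)
  qed
  have Xc: "continuous_on UNIV (\<lambda>q::real \<times> real. X (fst q - s1) (snd q))"
    using continuous_on_compose2[OF X(1), of UNIV "\<lambda>q. (fst q - s1, snd q)"]
    by (simp add: continuous_intros)
  show ?thesis
  proof (rule exI[of _ "\<lambda>s e. fst (X (s - s1) e)"], rule exI[of _ "\<lambda>s e. snd (X (s - s1) e)"],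
      intro conjI allI impI)
    fix e s :: real assume s: "s1 \<le> s"
    have X's: "((\<lambda>t. X t e) has_vector_derivative f (s - s1) e (X (s - s1) e)) (at (s - s1) within {0..})"
      using X'[of "s - s1"] s by simp
    from bounded_linear.has_vector_derivative[OF bounded_linear_fst X's]
    show "((\<lambda>s. fst (X (s - s1) e)) has_real_derivative snd (X (s - s1) e)) (at s within {s1..})"
      by (intro shift[of "\<lambda>t. fst (X t e)"]) (simp add: has_real_derivative_iff_has_vector_derivative f_def)
    from bounded_linear.has_vector_derivative[OF bounded_linear_snd X's]
    show "((\<lambda>s. snd (X (s - s1) e)) has_real_derivative T s e * ((m - 1) * snd (X (s - s1) e)
        + m / 2 * sin (2 * fst (X (s - s1) e)))) (at s within {s1..})"
      by (intro shift[of "\<lambda>t. snd (X t e)"]) (simp add: has_real_derivative_iff_has_vector_derivative f_def)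
  qed (auto simp: X(2) intro!: continuous_intros Xc)
qed

text \<open>For every value of the parameter there is a solution on the whole line that leaves the saddle like
\<open>h + pi / 2 ~ exp s\<close>. Near the saddle it is the one of \<open>singular_start\<close>, afterwards the one of
\<open>regular_continuation\<close>. Continuity is joint in time and parameter, and the asymptotics are uniform in the
parameter, including \<open>E e = 0\<close>, where the equation is autonomous.\<close>

lemma unstable_manifold_family:
  fixes m :: nat and E :: "real \<Rightarrow> real"
  assumes m: "1 \<le> m" and E: "continuous_on UNIV E" "\<And>e. 0 \<le> E e" "\<And>e. E e \<le> 1"
  shows "\<exists>h v. continuous_on UNIV (\<lambda>q. h (fst q) (snd q)) \<and> continuous_on UNIV (\<lambda>q. v (fst q) (snd q)) \<and>
    (\<forall>e. oscillator m (\<lambda>s. (E e * exp (2 * s) - 1) / (E e * exp (2 * s) + 1)) (\<lambda>s. h s e) (\<lambda>s. v s e)) \<and>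
    (\<exists>S. \<forall>s\<le>S. \<forall>e. \<bar>h s e + pi / 2 - exp s\<bar> \<le> exp (2 * s) \<and> \<bar>v s e - exp s\<bar> \<le> 2 * exp (2 * s))"
proof -
  define T where "T s e = (E e * exp (2 * s) - 1) / (E e * exp (2 * s) + 1)" for s e
  have pos: "0 < E e * exp (2 * s) + 1" for e s :: real
    using E(2)[of e] by (intro add_nonneg_pos mult_nonneg_nonneg) auto
  have T1: "\<bar>T s e\<bar> \<le> 1" for s e
  proof -
    have "0 \<le> E e * exp (2 * s)" using E(2) by simp
    then have "\<bar>E e * exp (2 * s) - 1\<bar> \<le> E e * exp (2 * s) + 1" by linarith
    then show ?thesis using pos[of e s] by (simp add: T_def abs_divide)
  qed
  have Ec: "continuous_on UNIV (\<lambda>q::real \<times> real. E (snd q))"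
    by (rule continuous_on_compose2[OF E(1)]) (auto intro!: continuous_intros)
  have Tc: "continuous_on UNIV (\<lambda>q. T (fst q) (snd q))"
    unfolding T_def using pos by (intro continuous_intros Ec) (auto simp: less_le)
  obtain y0 and a c :: "real \<Rightarrow> real \<Rightarrow> real" where y0: "0 < y0"
    and ac: "continuous_on ({0..y0} \<times> UNIV) (\<lambda>q. a (fst q) (snd q))"
    and cc: "continuous_on ({0..y0} \<times> UNIV) (\<lambda>q. c (fst q) (snd q))"
    and near: "\<And>y e. y \<in> {0..y0} \<Longrightarrow> \<bar>a y e - 1\<bar> \<le> y \<and> \<bar>c y e\<bar> \<le> 1"
    and a': "\<And>y e. y \<in> {0<..<y0} \<Longrightarrow> ((\<lambda>y. a y e) has_real_derivative c y e) (at y)"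
    and c': "\<And>y e. y \<in> {0<..<y0} \<Longrightarrow> ((\<lambda>y. c y e) has_real_derivative
         (slope_source m y (E e) (a y e) (c y e) - real (m + 2) * c y e) / y) (at y)"
    using singular_start[OF m E] by blast
  define h1 where "h1 s e = exp s * a (exp s) e - pi / 2" for s e
  define v1 where "v1 s e = exp s * a (exp s) e + (exp s)\<^sup>2 * c (exp s) e" for s e
  define F where "F s e h v = T s e * ((real m - 1) * v + real m / 2 * sin (2 * h))" for s e h v
  have d1: "((\<lambda>s. h1 s e) has_real_derivative v1 s e) (at s)" (is ?H)
    and d2: "((\<lambda>s. v1 s e) has_real_derivative F s e (h1 s e) (v1 s e)) (at s)" (is ?V)
    if "s < ln y0" for s e
  proof -
    have y: "exp s \<in> {0<..<y0}" using exp_less_mono[OF that] y0 by simp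
    let ?y = "exp s"
    let ?a = "a ?y e" and ?c = "c ?y e"
    have da: "((\<lambda>s. a (exp s) e) has_real_derivative ?c * ?y) (at s)"
      by (rule DERIV_chain2[OF a'[OF y] DERIV_exp])
    have dc: "((\<lambda>s. c (exp s) e) has_real_derivative slope_source m ?y (E e) ?a ?c - real (m + 2) * ?c) (at s)"
      using DERIV_chain2[OF c'[OF y] DERIV_exp] by simp
    show ?H unfolding h1_def v1_def
      by (auto intro!: derivative_eq_intros da simp: power2_eq_square algebra_simps)
    have "((\<lambda>s. v1 s e) has_real_derivative
        ?y * ?a + ?y * (?c * ?y) + (2 * ?y\<^sup>2 * ?c + ?y\<^sup>2 * (slope_source m ?y (E e) ?a ?c - real (m + 2) * ?c))) (at s)"
      unfolding v1_def by (auto intro!: derivative_eq_intros da dc simp: power2_eq_square algebra_simps)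
    moreover have "?y * ?a + ?y * (?c * ?y) + (2 * ?y\<^sup>2 * ?c + ?y\<^sup>2 * (slope_source m ?y (E e) ?a ?c - real (m + 2) * ?c))
        = F s e (h1 s e) (v1 s e)"
    proof -
      define Y where "Y = ?y"
      define \<epsilon> where "\<epsilon> = E e"
      define S where "S = sin (2 * (Y * a Y e))"
      have Y: "0 < Y" by (simp add: Y_def)
      have p: "0 < 1 + \<epsilon> * Y\<^sup>2" using E(2)[of e] by (intro add_pos_nonneg) (auto simp: \<epsilon>_def)
      have e2: "exp (2 * s) = Y\<^sup>2" by (simp add: Y_def exp_double)
      have sin: "sin (2 * (Y * a Y e - pi / 2)) = - S" by (simp add: S_def right_diff_distrib sin_diff)
      have TT: "T s e = -1 + 2 * \<epsilon> * Y\<^sup>2 / (1 + \<epsilon> * Y\<^sup>2)"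
        unfolding T_def e2 \<epsilon>_def[symmetric] using p by (simp add: field_simps)
      define W where "W = 2 * \<epsilon> * Y\<^sup>2 / (1 + \<epsilon> * Y\<^sup>2)"
      define \<sigma> where "\<sigma> = slope_source m Y \<epsilon> (a Y e) (c Y e)"
      define P where "P = (real m - 1) * (Y * a Y e + Y\<^sup>2 * c Y e) - real m / 2 * S"
      have "Y\<^sup>2 * (2 * \<epsilon> / (1 + \<epsilon> * Y\<^sup>2)) = W" by (simp add: W_def)
      moreover have "Y\<^sup>2 * (real m * ((S / 2 - Y * a Y e) / Y\<^sup>2)) = real m * (S / 2 - Y * a Y e)"
        using Y by simp
      ultimately have 1: "Y\<^sup>2 * \<sigma> = real m * (S / 2 - Y * a Y e) + W * P"
        unfolding \<sigma>_def slope_source_def S_def[symmetric] P_def[symmetric]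
        by (simp only: distrib_left mult.assoc[symmetric])
      have 2: "F s e (h1 s e) (v1 s e) = (-1 + W) * P"
        unfolding F_def h1_def v1_def TT Y_def[symmetric] sin P_def W_def by simp
      have "Y * a Y e + Y * (c Y e * Y) + (2 * Y\<^sup>2 * c Y e + Y\<^sup>2 * (\<sigma> - real (m + 2) * c Y e))
          = Y * a Y e + Y\<^sup>2 * c Y e - real m * Y\<^sup>2 * c Y e + Y\<^sup>2 * \<sigma>"
        by (simp add: algebra_simps power2_eq_square)
      also have "\<dots> = (-1 + W) * P" unfolding 1 by (simp add: P_def field_simps)
      finally show ?thesis
        unfolding Y_def[symmetric] \<epsilon>_def[symmetric] \<sigma>_def 2 .
    qed
    ultimately show ?V by simp
  qed
  \<comment> \<open>The factor one half leaves room for two-sided derivatives at the gluing time.\<close>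
  define s1 where "s1 = ln (y0 / 2)"
  have s1: "s1 < ln y0" "exp s1 \<le> y0" using y0 by (auto simp: s1_def)
  have h1c: "continuous_on ({..s1} \<times> UNIV) (\<lambda>q. h1 (fst q) (snd q))"
    and v1c: "continuous_on ({..s1} \<times> UNIV) (\<lambda>q. v1 (fst q) (snd q))"
  proof -
    have sub: "(\<lambda>q::real \<times> real. (exp (fst q), snd q)) ` ({..s1} \<times> UNIV) \<subseteq> {0..y0} \<times> UNIV"
      using s1(2) by (auto intro: order_trans[of _ "exp s1"])
    have pc: "continuous_on ({..s1} \<times> UNIV) (\<lambda>q::real \<times> real. (exp (fst q), snd q))"
      by (intro continuous_intros)
    note 1 = continuous_on_compose2[OF ac pc sub, simplified]
      and 2 = continuous_on_compose2[OF cc pc sub, simplified]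
    show "continuous_on ({..s1} \<times> UNIV) (\<lambda>q. h1 (fst q) (snd q))"
      and "continuous_on ({..s1} \<times> UNIV) (\<lambda>q. v1 (fst q) (snd q))"
      unfolding h1_def v1_def by (intro continuous_intros 1 2)+
  qed
  have h1_near: "\<bar>h1 s e + pi / 2 - exp s\<bar> \<le> exp (2 * s)"
    and v1_near: "\<bar>v1 s e - exp s\<bar> \<le> 2 * exp (2 * s)" if "s \<le> s1" for s e
  proof -
    have y: "exp s \<in> {0..y0}" using that s1(2) by (auto intro: order_trans[of _ "exp s1"])
    have e2: "exp (2 * s) = exp s * exp s" by (simp add: exp_double power2_eq_square)
    have 1: "\<bar>exp s * a (exp s) e - exp s\<bar> \<le> exp (2 * s)"
    proof -
      have "exp s * a (exp s) e - exp s = exp s * (a (exp s) e - 1)" by (simp add: algebra_simps)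
      then show ?thesis using near[OF y, of e] by (simp add: abs_mult e2)
    qed
    then show "\<bar>h1 s e + pi / 2 - exp s\<bar> \<le> exp (2 * s)" by (simp add: h1_def)
    have "\<bar>(exp s)\<^sup>2 * c (exp s) e\<bar> \<le> exp (2 * s) * 1"
      using near[OF y, of e] by (simp add: abs_mult e2 power2_eq_square)
    then show "\<bar>v1 s e - exp s\<bar> \<le> 2 * exp (2 * s)" using 1 unfolding v1_def by linarith
  qed
  define C where "C = 2 * exp (2 * s1) + exp s1 + pi / 2"
  have init: "\<exists>h v. continuous_on UNIV (\<lambda>q. h (fst q) (snd q)) \<and> continuous_on UNIV (\<lambda>q. v (fst q) (snd q)) \<and>
    (\<forall>e. h s1 e = h1 s1 e \<and> v s1 e = v1 s1 e) \<and>
    (\<forall>e. \<forall>s\<ge>s1. ((\<lambda>s. h s e) has_real_derivative v s e) (at s within {s1..}) \<and>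
       ((\<lambda>s. v s e) has_real_derivative T s e * ((real m - 1) * v s e + real m / 2 * sin (2 * h s e))) (at s within {s1..}))"
  proof (rule regular_continuation[where C = C])
    have pc: "continuous_on UNIV (\<lambda>e::real. (s1, e))" by (intro continuous_intros)
    have sub: "range (\<lambda>e::real. (s1, e)) \<subseteq> {..s1} \<times> UNIV" by auto
    show "continuous_on UNIV (h1 s1)" "continuous_on UNIV (v1 s1)"
      using continuous_on_compose2[OF h1c pc sub] continuous_on_compose2[OF v1c pc sub] by simp_all
    have "0 < exp (2 * s1)" "0 < exp s1" by simp_all
    then show "\<bar>h1 s1 e\<bar> \<le> C" "\<bar>v1 s1 e\<bar> \<le> C" for e
      using h1_near[of s1 e] v1_near[of s1 e] pi_gt_zero unfolding C_def by linarith+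
  qed (use m Tc T1 in auto)
  then obtain h2 v2 where h2c: "continuous_on UNIV (\<lambda>q. h2 (fst q) (snd q))"
    and v2c: "continuous_on UNIV (\<lambda>q. v2 (fst q) (snd q))"
    and at1: "\<And>e. h2 s1 e = h1 s1 e" "\<And>e. v2 s1 e = v1 s1 e"
    and d3: "\<And>s e. s1 \<le> s \<Longrightarrow> ((\<lambda>s. h2 s e) has_real_derivative v2 s e) (at s within {s1..})"
    and d4: "\<And>s e. s1 \<le> s \<Longrightarrow> ((\<lambda>s. v2 s e) has_real_derivative F s e (h2 s e) (v2 s e)) (at s within {s1..})"
    unfolding F_def by blast
  define h where "h s e = (if s \<le> s1 then h1 s e else h2 s e)" for s e
  define v where "v s e = (if s \<le> s1 then v1 s e else v2 s e)" for s e
  have glue: "((\<lambda>s. if s \<le> s1 then f s else g s) has_real_derivative (if s \<le> s1 then f' s else g' s)) (at s)"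
    if f: "\<And>s. s < ln y0 \<Longrightarrow> (f has_real_derivative f' s) (at s)"
      and g: "\<And>s. s1 \<le> s \<Longrightarrow> (g has_real_derivative g' s) (at s within {s1..})"
      and eq: "f s1 = g s1" "f' s1 = g' s1" for f g f' g' s
  proof -
    consider "s < s1" | "s = s1" | "s1 < s" by linarith
    then show ?thesis
    proof cases
      case 1
      then have "(f has_real_derivative f' s) (at s)" using f s1 by simp
      then have "((\<lambda>s. if s \<le> s1 then f s else g s) has_real_derivative f' s) (at s)"
        by (rule has_field_derivative_transform_within_open[of _ _ _ "{..<s1}"]) (use 1 in auto)
      then show ?thesis using 1 by simp
    next
      case 2
      have "(f has_real_derivative f' s1) (at s1)" by (rule f[OF s1(1)])
      moreover have "(g has_real_derivative f' s1) (at s1 within {s1..})" using g[of s1] eq(2) by simp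
      ultimately have "((\<lambda>s. if s \<le> s1 then f s else g s) has_real_derivative f' s1) (at s1)"
        using eq(1) by (rule DERIV_glue_at)
      then show ?thesis using 2 by simp
    next
      case 3
      have "at s within {s1..} = at s" 
        using 3 by (intro at_within_nhd[of s "{s1<..}"]) auto
      then have "(g has_real_derivative g' s) (at s)" using g[of s] 3 by simp
      then have "((\<lambda>s. if s \<le> s1 then f s else g s) has_real_derivative g' s) (at s)"
        by (rule has_field_derivative_transform_within_open[of _ _ _ "{s1<..}"]) (use 3 in auto)
      then show ?thesis using 3 by simp
    qed
  qed
  have gluec: "continuous_on UNIV (\<lambda>q. if fst q \<le> s1 then f (fst q) (snd q) else g (fst q) (snd q))"
    if "continuous_on ({..s1} \<times> UNIV) (\<lambda>q. f (fst q) (snd q))" "continuous_on UNIV (\<lambda>q. g (fst q) (snd q))"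
      "\<And>e. f s1 e = g s1 e" for f g :: "real \<Rightarrow> real \<Rightarrow> real"
  proof (rule continuous_on_cases_le)
    show "continuous_on {q \<in> UNIV. fst q \<le> s1} (\<lambda>q. f (fst q) (snd q))"
      by (rule continuous_on_subset[OF that(1)]) auto
    show "continuous_on {q \<in> UNIV. s1 \<le> fst q} (\<lambda>q. g (fst q) (snd q))"
      by (rule continuous_on_subset[OF that(2)]) auto
  qed (use that(3) in \<open>auto intro: continuous_on_fst continuous_on_id\<close>)
  show ?thesis
  proof (rule exI[of _ h], rule exI[of _ v], intro conjI allI exI[of _ s1] impI)
    show "continuous_on UNIV (\<lambda>q. h (fst q) (snd q))" "continuous_on UNIV (\<lambda>q. v (fst q) (snd q))"
      unfolding h_def v_def by (intro gluec h1c h2c v1c v2c at1[symmetric])+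
    show "\<bar>h s e + pi / 2 - exp s\<bar> \<le> exp (2 * s)" "\<bar>v s e - exp s\<bar> \<le> 2 * exp (2 * s)" if "s \<le> s1" for s e
      using h1_near[OF that] v1_near[OF that] that by (auto simp: h_def v_def)
    fix e
    show "oscillator m (\<lambda>s. (E e * exp (2 * s) - 1) / (E e * exp (2 * s) + 1)) (\<lambda>s. h s e) (\<lambda>s. v s e)"
      unfolding oscillator_def T_def[symmetric]
    proof (intro allI conjI)
      fix s
      show "((\<lambda>s. h s e) has_real_derivative v s e) (at s)"
        unfolding h_def v_def by (rule glue[OF d1 d3]) (auto simp: at1)
      have "((\<lambda>s. v s e) has_real_derivative (if s \<le> s1 then F s e (h1 s e) (v1 s e) else F s e (h2 s e) (v2 s e))) (at s)"
        unfolding v_def by (rule glue[OF d2 d4]) (auto simp: at1)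
      then show "((\<lambda>s. v s e) has_real_derivative T s e * ((real m - 1) * v s e + real m / 2 * sin (2 * h s e))) (at s)"
        by (simp add: F_def h_def v_def split: if_splits)
    qed
  qed
qed

section \<open>Confinement while the oscillator is damped\<close>

lemma oscillatorD:
  assumes "oscillator m T h v"
  shows "(h has_real_derivative v s) (at s)"
    and "(v has_real_derivative T s * ((m - 1) * v s + m / 2 * sin (2 * h s))) (at s)"
  using assms by (auto simp: oscillator_def)

lemma oscillator_cont:
  assumes "oscillator m T h v"
  shows "continuous_on A h" "continuous_on A v"
  by (auto intro!: continuous_at_imp_continuous_on DERIV_isCont oscillatorD[OF assms])

lemma oscillator_minus:
  "oscillator m T h v \<Longrightarrow> oscillator m T (\<lambda>s. - h s) (\<lambda>s. - v s)"
  unfolding oscillator_def by (auto intro!: derivative_eq_intros simp: algebra_simps)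

lemma cos_nonzero_strip:
  fixes h :: "real \<Rightarrow> real"
  assumes c: "continuous_on {a..b} h" and a: "\<bar>h a\<bar> < pi / 2" and cos: "\<And>s. s \<in> {a..b} \<Longrightarrow> cos (h s) \<noteq> 0"
    and s: "s \<in> {a..b}"
  shows "\<bar>h s\<bar> < pi / 2"
proof (rule ccontr)
  assume "\<not> \<bar>h s\<bar> < pi / 2"
  moreover have "continuous_on {a..s} (\<lambda>x. \<bar>h x\<bar>)"
    using c s by (intro continuous_intros) (auto elim: continuous_on_subset)
  ultimately obtain z where z: "z \<in> {a..s}" "\<bar>h z\<bar> = pi / 2"
    using IVT'[of "\<lambda>x. \<bar>h x\<bar>" a "pi / 2" s] a s by auto
  have "cos \<bar>h z\<bar> = 0" unfolding z(2) by (rule cos_pi_half)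
  then show False using cos[of z] z(1) s by simp
qed

text \<open>The quantity \<open>v\<^sup>2 / (- 2 T) + m / 2 * (sin h)\<^sup>2\<close> is an energy that decreases as long as the damping
dominates the decay of \<open>- T\<close>, which is the hypothesis \<open>slow\<close>. Its value \<open>m / 2\<close> is the height of the
potential at the edges \<open>h = - pi / 2\<close> and \<open>h = pi / 2\<close>, so a solution starting below this level never gets there.\<close>

lemma energy_trap:
  fixes m :: real
  assumes osc: "oscillator m T h v" and m: "0 < m"
    and T: "\<And>s. s \<in> {a..b} \<Longrightarrow> T s < 0"
    and T': "\<And>s. s \<in> {a..b} \<Longrightarrow> (T has_real_derivative T' s) (at s)"
    and slow: "\<And>s. s \<in> {a..b} \<Longrightarrow> T' s \<le> (m - 1) * (2 * (T s)\<^sup>2)"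
    and start: "\<bar>h a\<bar> < pi / 2" "(v a)\<^sup>2 < m * (- T a) * (cos (h a))\<^sup>2"
    and s: "s \<in> {a..b}"
  shows "\<bar>h s\<bar> < pi / 2 \<and> (v s)\<^sup>2 < m * (- T s) * (cos (h s))\<^sup>2"
proof -
  define J where "J s = m / 2 * (sin (h s))\<^sup>2 - (v s)\<^sup>2 / (2 * T s)" for s
  have J_iff: "J s < m / 2 \<longleftrightarrow> (v s)\<^sup>2 < m * (- T s) * (cos (h s))\<^sup>2" if "s \<in> {a..b}" for s
  proof -
    have "J s = m / 2 + ((v s)\<^sup>2 / (2 * (- T s)) - m / 2 * (cos (h s))\<^sup>2)"
      by (simp add: J_def sin_squared_eq right_diff_distrib)
    then have "J s < m / 2 \<longleftrightarrow> (v s)\<^sup>2 / (2 * (- T s)) < m / 2 * (cos (h s))\<^sup>2" by linarith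
    also have "\<dots> \<longleftrightarrow> (v s)\<^sup>2 < m / 2 * (cos (h s))\<^sup>2 * (2 * (- T s))"
      using T[OF that] by (intro pos_divide_less_eq) simp
    finally show ?thesis by (simp add: mult_ac)
  qed
  have J': "(J has_real_derivative (v s)\<^sup>2 * (T' s / (2 * (T s)\<^sup>2) - (m - 1))) (at s)" if "s \<in> {a..b}" for s
  proof -
    have T0: "T s \<noteq> 0" using T[OF that] by simp
    define q where "q = T s * ((m - 1) * v s + m / 2 * sin (2 * h s))"
    have v': "(v has_real_derivative q) (at s)" using oscillatorD(2)[OF osc] by (simp add: q_def)
    have "(J has_real_derivative m / 2 * (2 * sin (h s) * (cos (h s) * v s))
        - (2 * v s * q * (2 * T s) - (v s)\<^sup>2 * (2 * T' s)) / (2 * T s * (2 * T s))) (at s)"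
      unfolding J_def[abs_def] using T0
      by (auto intro!: derivative_eq_intros oscillatorD(1)[OF osc] v' T'[OF that])
    moreover have "m / 2 * (2 * sin (h s) * (cos (h s) * v s))
        - (2 * v s * q * (2 * T s) - (v s)\<^sup>2 * (2 * T' s)) / (2 * T s * (2 * T s))
        = (v s)\<^sup>2 * (T' s / (2 * (T s)\<^sup>2) - (m - 1))"
      using T0 unfolding q_def sin_double by (simp add: field_simps power2_eq_square)
    ultimately show ?thesis by simp
  qed
  have J_less: "J x < m / 2" if x: "x \<in> {a..b}" for x
  proof -
    have "J x \<le> J a"
    proof (rule DERIV_nonpos_imp_nonincreasing[where f = J])
      show "a \<le> x" using x by simp
      fix z assume "a \<le> z" "z \<le> x"
      then have z: "z \<in> {a..b}" using x by simp
      have "T' z / (2 * (T z)\<^sup>2) \<le> m - 1"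
        by (rule mult_imp_div_pos_le[OF _ slow[OF z]]) (use T[OF z] in simp)
      then have "T' z / (2 * (T z)\<^sup>2) - (m - 1) \<le> 0" by simp
      then have "(v z)\<^sup>2 * (T' z / (2 * (T z)\<^sup>2) - (m - 1)) \<le> 0" by (simp add: mult_nonneg_nonpos)
      then show "\<exists>y. (J has_real_derivative y) (at z) \<and> y \<le> 0" using J'[OF z] by blast
    qed
    also have "J a < m / 2" using J_iff[of a] start x by auto
    finally show ?thesis .
  qed
  have bound: "(v x)\<^sup>2 < m * (- T x) * (cos (h x))\<^sup>2" if "x \<in> {a..b}" for x
    using J_iff J_less that by blast
  have "cos (h x) \<noteq> 0" if "x \<in> {a..b}" for x
    using bound[OF that] by (auto simp: not_less[symmetric])
  from cos_nonzero_strip[OF oscillator_cont(1)[OF osc] start(1) this s] bound[OF s] show ?thesis by simp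
qed

text \<open>First and last passage below a level, used wherever a solution is followed up to the first violation
of a bound.\<close>

lemma first_sublevel_point:
  fixes f :: "real \<Rightarrow> real"
  assumes c: "continuous_on {a..b} f" and x: "x \<in> {a..b}" "f x \<le> c"
  obtains z where "z \<in> {a..x}" "f z \<le> c" "\<And>y. y \<in> {a..<z} \<Longrightarrow> c < f y"
proof -
  let ?S = "{y \<in> {a..x}. f y \<le> c}"
  have "compact ?S"
    using x c by (intro compact_eq_bounded_closed[THEN iffD2] conjI bounded_subset[OF bounded_closed_interval]
        continuous_on_closed_Collect_le continuous_on_const) (auto elim: continuous_on_subset)
  moreover have "?S \<noteq> {}" using x by auto
  ultimately obtain z where z: "z \<in> ?S" "\<forall>t\<in>?S. z \<le> t"
    using compact_attains_inf[of ?S] by blast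
  have "c < f y" if "y \<in> {a..<z}" for y
  proof (rule ccontr)
    assume "\<not> c < f y"
    then have "y \<in> ?S" using that z(1) by auto
    then show False using that z(2) by auto
  qed
  then show thesis using z(1) by (intro that[of z]) auto
qed

lemma last_sublevel_point:
  fixes f :: "real \<Rightarrow> real"
  assumes c: "continuous_on {a..b} f" and x: "x \<in> {a..b}" "f x \<le> c"
  obtains z where "z \<in> {x..b}" "f z \<le> c" "\<And>y. y \<in> {z<..b} \<Longrightarrow> c < f y"
proof -
  let ?S = "{y \<in> {x..b}. f y \<le> c}"
  have "compact ?S"
    using x c by (intro compact_eq_bounded_closed[THEN iffD2] conjI bounded_subset[OF bounded_closed_interval]
        continuous_on_closed_Collect_le continuous_on_const) (auto elim: continuous_on_subset)
  moreover have "?S \<noteq> {}" using x by auto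
  ultimately obtain z where z: "z \<in> ?S" "\<forall>t\<in>?S. t \<le> z"
    using compact_attains_sup[of ?S] by blast
  have "c < f y" if "y \<in> {z<..b}" for y
  proof (rule ccontr)
    assume "\<not> c < f y"
    then have "y \<in> ?S" using that z(1) by auto
    then show False using that z(2) by auto
  qed
  then show thesis using z(1) by (intro that[of z]) auto
qed

lemma nonincreasing_while_pos:
  fixes f :: "real \<Rightarrow> real"
  assumes ab: "a \<le> b" and f: "\<And>x. x \<in> {a..b} \<Longrightarrow> (f has_real_derivative f' x) (at x)"
    and neg: "\<And>x. x \<in> {a..b} \<Longrightarrow> 0 < f x \<Longrightarrow> f' x \<le> 0"
  shows "f b \<le> max 0 (f a)"
proof -
  have c: "continuous_on {a..b} f"
    by (rule continuous_at_imp_continuous_on) (auto intro: DERIV_isCont f)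
  have decr: "f b \<le> f z" if z: "z \<in> {a..b}" and pos: "\<And>y. y \<in> {z<..b} \<Longrightarrow> 0 < f y" for z
  proof (cases "z < b")
    case True
    then obtain \<xi> where \<xi>: "z < \<xi>" "\<xi> < b" "f b - f z = (b - z) * f' \<xi>"
      using MVT2[OF True, of f f'] f z by (meson atLeastAtMost_iff order_trans)
    then have "(b - z) * f' \<xi> \<le> 0"
      using neg[of \<xi>] pos[of \<xi>] z by (intro mult_nonneg_nonpos) auto
    then show ?thesis using \<xi>(3) by simp
  qed (use z in auto)
  show ?thesis
  proof (cases "\<exists>x\<in>{a..b}. f x \<le> 0")
    case True
    then obtain x where x: "x \<in> {a..b}" "f x \<le> 0" by blast
    obtain z where z: "z \<in> {x..b}" "f z \<le> 0" "\<And>y. y \<in> {z<..b} \<Longrightarrow> 0 < f y"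
      by (rule last_sublevel_point[OF c x]) blast
    have "f b \<le> f z" using z(1) x(1) by (intro decr z(3)) auto
    then show ?thesis using z(2) by simp
  next
    case False
    have "f b \<le> f a"
    proof (rule decr)
      fix y assume "y \<in> {a<..b}"
      then show "0 < f y" using False by (intro not_le_imp_less notI) auto
    qed (use ab in simp)
    then show ?thesis by simp
  qed
qed

lemma tanh_deriv: "(tanh has_real_derivative 1 - (tanh x)\<^sup>2) (at (x::real))"
  by (auto intro!: derivative_eq_intros)

text \<open>Close to the turning point \<open>x = 0\<close> the coefficient vanishes and the energy of \<open>energy_trap\<close>
blows up. There the argument is that too little time is left: on \<open>{- X..0}\<close> the speed is at most
\<open>sqrt (m * tanh X)\<close>, hence at most \<open>1 / X\<close>, so a solution that is at or below \<open>0\<close> at some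
time cannot reach \<open>pi / 2\<close>. One that stays positive is decelerated, and its initial
speed is small compared with its distance from \<open>pi / 2\<close> by the energy bound \<open>start\<close>.\<close>

lemma no_overshoot_near_zero:
  fixes m :: real
  assumes osc: "oscillator m tanh h v" and m: "1 \<le> m" and X: "0 < X" "X\<^sup>2 * (m * tanh X) \<le> 1"
    and start: "\<bar>h (- X)\<bar> < pi / 2" "(v (- X))\<^sup>2 < m * tanh X * (cos (h (- X)))\<^sup>2"
    and x: "x \<in> {- X..0}"
  shows "h x < pi / 2"
proof (rule ccontr)
  assume "\<not> h x < pi / 2"
  then have hx: "- h x \<le> - (pi / 2)" "x \<in> {- X..x}" using x by auto
  obtain x1 where x1: "x1 \<in> {- X..x}" "- h x1 \<le> - (pi / 2)"
    and "\<And>y. y \<in> {- X..<x1} \<Longrightarrow> - (pi / 2) < - h y"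
    by (rule first_sublevel_point[OF continuous_on_minus[OF oscillator_cont(1)[OF osc]] hx(2,1)]) blast
  then have x1: "x1 \<in> {- X..x}" "pi / 2 \<le> h x1" and before: "\<And>y. y \<in> {- X..<x1} \<Longrightarrow> h y < pi / 2"
    by auto
  have "x1 \<noteq> - X" using x1(2) start(1) by auto
  then have x1': "- X < x1" "x1 \<le> 0" using x1(1) x by auto
  \<comment> \<open>Not divided by the coefficient, the energy decreases up to the turning point and bounds the speed.\<close>
  define W where "W s = (v s)\<^sup>2 - m * (tanh s * (sin (h s))\<^sup>2)" for s
  have W': "(W has_real_derivative 2 * (m - 1) * tanh s * (v s)\<^sup>2 - m * (1 - (tanh s)\<^sup>2) * (sin (h s))\<^sup>2) (at s)" for s
  proof -
    define q where "q = tanh s * ((m - 1) * v s + m / 2 * sin (2 * h s))"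
    have v': "(v has_real_derivative q) (at s)" using oscillatorD(2)[OF osc] by (simp add: q_def)
    have "(W has_real_derivative 2 * v s * q - m * ((1 - (tanh s)\<^sup>2) * (sin (h s))\<^sup>2
        + 2 * sin (h s) * (cos (h s) * v s) * tanh s)) (at s)"
      unfolding W_def[abs_def]
      by (auto intro!: derivative_eq_intros oscillatorD(1)[OF osc] v')
    moreover have "2 * v s * q - m * ((1 - (tanh s)\<^sup>2) * (sin (h s))\<^sup>2
        + 2 * sin (h s) * (cos (h s) * v s) * tanh s)
        = 2 * (m - 1) * tanh s * (v s)\<^sup>2 - m * (1 - (tanh s)\<^sup>2) * (sin (h s))\<^sup>2"
      unfolding q_def sin_double by (simp add: power2_eq_square algebra_simps)
    ultimately show ?thesis by (simp only:)
  qed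
  have speed: "(X * v s)\<^sup>2 < 1" if s: "s \<in> {- X..0}" for s
  proof -
    have "W s \<le> W (- X)"
    proof (rule DERIV_nonpos_imp_nonincreasing[where f = W])
      show "- X \<le> s" using s by simp
      fix z assume "- X \<le> z" "z \<le> s"
      then have "z \<le> 0" using s by simp
      have "2 * (m - 1) * tanh z * (v z)\<^sup>2 \<le> 0"
        using \<open>z \<le> 0\<close> m by (intro mult_nonpos_nonneg mult_nonneg_nonpos) auto
      moreover have "0 \<le> m * (1 - (tanh z)\<^sup>2) * (sin (h z))\<^sup>2"
      proof -
        have "(tanh z)\<^sup>2 \<le> 1" using tanh_real_bounds[of z] by (auto simp: abs_square_le_1 abs_le_iff)
        then show ?thesis using m by (intro mult_nonneg_nonneg) simp_all
      qed
      ultimately have "2 * (m - 1) * tanh z * (v z)\<^sup>2 - m * (1 - (tanh z)\<^sup>2) * (sin (h z))\<^sup>2 \<le> 0" by linarith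
      then show "\<exists>y. (W has_real_derivative y) (at z) \<and> y \<le> 0" using W'[of z] by blast
    qed
    moreover have "W (- X) < m * tanh X"
    proof -
      have "m * tanh X * (cos (h (- X)))\<^sup>2 + m * tanh X * (sin (h (- X)))\<^sup>2 = m * tanh X"
        by (simp add: sin_squared_eq algebra_simps)
      then show ?thesis using start(2) by (simp add: W_def mult.assoc)
    qed
    moreover have "(v s)\<^sup>2 \<le> W s"
    proof -
      have "m * (tanh s * (sin (h s))\<^sup>2) \<le> 0"
        using s m by (intro mult_nonneg_nonpos mult_nonpos_nonneg) simp_all
      then show ?thesis by (simp add: W_def)
    qed
    ultimately have "X\<^sup>2 * (v s)\<^sup>2 < X\<^sup>2 * (m * tanh X)" using X(1) by simp
    then show ?thesis using X(2) by (simp add: power_mult_distrib)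
  qed
  have speed1: "X * v s < 1" if "s \<in> {- X..0}" for s
    using speed[OF that] by (simp add: abs_square_less_1)
  show False
  proof (cases "\<exists>z\<in>{- X..x1}. h z \<le> 0")
    case True
    then obtain z where z: "z \<in> {- X..x1}" "h z \<le> 0" by blast
    then have "z < x1" using x1(2) pi_half_gt_zero by (cases "z = x1") auto
    from MVT2[OF this, of h v] obtain \<xi> where \<xi>: "z < \<xi>" "\<xi> < x1" "h x1 - h z = (x1 - z) * v \<xi>"
      using oscillatorD(1)[OF osc] by blast
    have pos: "0 < (x1 - z) * v \<xi>" using \<xi>(3) x1(2) z(2) pi_half_gt_zero by linarith
    then have "0 < v \<xi>" using \<open>z < x1\<close> by (simp add: zero_less_mult_iff)
    then have "(x1 - z) * v \<xi> \<le> X * v \<xi>" using z(1) x1' by (intro mult_right_mono) auto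
    also have "\<dots> < 1" using \<xi> z x1' by (intro speed1) auto
    finally show False using \<xi>(3) x1(2) z(2) pi_gt3 by linarith
  next
    case False
    then have hpos: "0 < h z" if "z \<in> {- X..x1}" for z using that by force
    from MVT2[OF x1'(1), of h v] obtain \<xi> where \<xi>: "- X < \<xi>" "\<xi> < x1" "h x1 - h (- X) = (x1 + X) * v \<xi>"
      using oscillatorD(1)[OF osc] by force
    have pos: "0 < (x1 + X) * v \<xi>" using \<xi>(3) x1(2) start(1) by linarith
    then have v\<xi>: "0 < v \<xi>" using x1' by (simp add: zero_less_mult_iff)
    have "v \<xi> \<le> max 0 (v (- X))"
    proof (rule nonincreasing_while_pos[where f = v and f' = "\<lambda>y. tanh y * ((m - 1) * v y + m / 2 * sin (2 * h y))"])
      fix y assume y: "y \<in> {- X..\<xi>}" and vy: "0 < v y"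
      then have "0 \<le> sin (2 * h y)" using hpos[of y] before[of y] \<xi> by (intro sin_ge_zero) auto
      then have "0 \<le> (m - 1) * v y + m / 2 * sin (2 * h y)" using m vy by simp
      then show "tanh y * ((m - 1) * v y + m / 2 * sin (2 * h y)) \<le> 0"
        using y \<xi> x1' by (intro mult_nonpos_nonneg) auto
    qed (use \<xi> oscillatorD(2)[OF osc] in auto)
    then have vle: "v \<xi> \<le> v (- X)" "0 < v (- X)" using v\<xi> by auto
    define d where "d = pi / 2 - h (- X)"
    have d: "0 < d" using start(1) by (auto simp: d_def)
    have cosd: "cos (h (- X)) = sin d" by (simp add: d_def sin_diff)
    have "(X * v (- X))\<^sup>2 < (X\<^sup>2 * (m * tanh X)) * (sin d)\<^sup>2"
      using start(2) X(1) unfolding cosd by (simp add: power_mult_distrib mult.assoc)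
    also have "\<dots> \<le> 1 * (sin d)\<^sup>2" using X(2) by (intro mult_right_mono) auto
    also have "\<dots> \<le> d\<^sup>2"
      using abs_sin_x_le_abs_x[of d] by (simp add: abs_le_square_iff)
    finally have "X * v (- X) < d" using d by (simp add: power_less_imp_less_base)
    moreover have "(x1 + X) * v \<xi> \<le> X * v (- X)" using x1' v\<xi> vle X by (intro mult_mono) auto
    ultimately show False using \<xi>(3) x1(2) unfolding d_def by linarith
  qed
qed

text \<open>The two previous arguments meet at the point \<open>- X\<close> where \<open>slow\<close> in \<open>energy_trap\<close> becomes an
equality for \<open>T = tanh\<close>, that is \<open>(tanh X)\<^sup>2 = 1 / (2 m - 1)\<close>.\<close>

lemma strip_before_turning:
  fixes m :: real
  assumes osc: "oscillator m tanh h v" and m: "2 \<le> m"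
    and start: "\<And>s. s \<le> S \<Longrightarrow> \<bar>h s\<bar> < pi / 2 \<and> (v s)\<^sup>2 < m * (- tanh s) * (cos (h s))\<^sup>2"
    and x: "x \<le> 0"
  shows "\<bar>h x\<bar> < pi / 2"
proof -
  define X where "X = arsinh (1 / sqrt (2 * m - 2))"
  have sX: "(sinh X)\<^sup>2 = 1 / (2 * m - 2)" using m by (simp add: X_def power_divide)
  have X: "0 < X" using m by (simp add: X_def)
  have cX: "(cosh X)\<^sup>2 = (2 * m - 1) / (2 * m - 2)"
    using m by (simp add: cosh_square_eq sX field_simps)
  have tX: "(tanh X)\<^sup>2 = 1 / (2 * m - 1)" using m by (simp add: tanh_def power_divide sX cX)
  have tX0: "0 < tanh X" "tanh X < 1" using X tanh_real_lt_1 by auto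
  have X_sinh: "X \<le> sinh X"
  proof -
    have "sinh 0 - 0 \<le> sinh X - X"
    proof (rule DERIV_nonneg_imp_nondecreasing[where f = "\<lambda>x. sinh x - x"])
      show "0 \<le> X" using X by simp
      fix x :: real
      have "((\<lambda>x. sinh x - x) has_real_derivative cosh x - 1) (at x)" by (auto intro!: derivative_eq_intros)
      then show "\<exists>y. ((\<lambda>x. sinh x - x) has_real_derivative y) (at x) \<and> 0 \<le> y"
        using cosh_real_ge_1[of x] by force
    qed
    then show ?thesis by simp
  qed
  have short: "X\<^sup>2 * (m * tanh X) \<le> 1"
  proof -
    have "X\<^sup>2 * (m * tanh X) \<le> (sinh X)\<^sup>2 * (m * 1)"
      using X X_sinh tX0 m by (intro mult_mono power_mono) auto
    also have "\<dots> \<le> 1" using m unfolding sX by (simp add: divide_le_eq)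
    finally show ?thesis .
  qed
  have slow: "1 - (tanh s)\<^sup>2 \<le> (m - 1) * (2 * (tanh s)\<^sup>2)" if "s \<le> - X" for s
  proof -
    have "tanh X \<le> tanh (- s)" unfolding tanh_real_le_iff using that by simp
    then have "tanh X \<le> - tanh s" by simp
    then have "1 / (2 * m - 1) \<le> (tanh s)\<^sup>2" using tX0 tX power_mono[of "tanh X" "- tanh s" 2] by simp
    then show ?thesis using m by (simp add: field_simps)
  qed
  have early: "\<bar>h s\<bar> < pi / 2 \<and> (v s)\<^sup>2 < m * (- tanh s) * (cos (h s))\<^sup>2" if s: "s \<le> - X" for s
  proof (rule energy_trap[OF osc])
    show "\<bar>h (min s S)\<bar> < pi / 2" "(v (min s S))\<^sup>2 < m * (- tanh (min s S)) * (cos (h (min s S)))\<^sup>2"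
      using start[of "min s S"] by auto
    show "s \<in> {min s S..s}" by simp
    fix z assume "z \<in> {min s S..s}"
    then have z: "z \<le> - X" using s by simp
    show "tanh z < 0" using z X by simp
    show "(tanh has_real_derivative 1 - (tanh z)\<^sup>2) (at z)" by (rule tanh_deriv)
    show "1 - (tanh z)\<^sup>2 \<le> (m - 1) * (2 * (tanh z)\<^sup>2)" by (rule slow[OF z])
  qed (use m in auto)
  show ?thesis
  proof (cases "x \<le> - X")
    case True
    then show ?thesis using early by blast
  next
    case False
    then have x': "x \<in> {- X..0}" using x by simp
    have start': "\<bar>h (- X)\<bar> < pi / 2" "(v (- X))\<^sup>2 < m * tanh X * (cos (h (- X)))\<^sup>2"
      using early[of "- X"] by auto
    have "h x < pi / 2" by (rule no_overshoot_near_zero[OF osc _ X short start' x']) (use m in simp)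
    moreover have "- h x < pi / 2"
      by (rule no_overshoot_near_zero[OF oscillator_minus[OF osc] _ X short _ _ x']) (use m start' in auto)
    ultimately show ?thesis by simp
  qed
qed

section \<open>Oscillation of the autonomous damped equation\<close>

lemma no_bounded_linear_decrease:
  fixes f :: "real \<Rightarrow> real"
  assumes f: "\<And>s. a \<le> s \<Longrightarrow> (f has_real_derivative f' s) (at s)"
    and decr: "\<And>s. a \<le> s \<Longrightarrow> f' s \<le> - \<delta>" and \<delta>: "0 < \<delta>"
    and bound: "\<And>s. a \<le> s \<Longrightarrow> B \<le> f s"
  shows False
proof -
  define s where "s = a + (f a - B) / \<delta> + 1"
  have "0 \<le> (f a - B) / \<delta>" using bound[of a] \<delta> by simp
  then have "a < s" by (simp add: s_def)
  then obtain z where z: "a < z" "f s - f a = (s - a) * f' z"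
    using MVT2[of a s f f'] f by auto
  have "(s - a) * f' z \<le> (s - a) * - \<delta>"
    using decr[of z] z(1) \<open>a < s\<close> by (intro mult_left_mono) auto
  also have "\<dots> = B - f a - \<delta>" using \<delta> by (simp add: s_def field_simps)
  finally show False using bound[of s] z(2) \<open>a < s\<close> \<delta> by simp
qed

text \<open>Uniqueness backwards in time for the equilibrium \<open>h = 0\<close>, by Gronwall's inequality for
\<open>h\<^sup>2 + v\<^sup>2\<close>. It shows that solutions leaving the saddle never meet the origin of the phase plane,
so that their phase angle makes sense.\<close>

lemma oscillator_rest:
  fixes m :: real
  assumes osc: "oscillator m T h v" and T: "\<And>s. \<bar>T s\<bar> \<le> 1" and m: "1 \<le> m"
    and rest: "h b = 0" "v b = 0" and s: "s \<le> b"
  shows "h s = 0"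
proof -
  define e where "e s = (h s)\<^sup>2 + (v s)\<^sup>2" for s
  define e' where "e' s = 2 * h s * v s + 2 * v s * (T s * ((m - 1) * v s + m / 2 * sin (2 * h s)))" for s
  have e: "(e has_real_derivative e' s) (at s)" for s
    unfolding e_def[abs_def] e'_def by (auto intro!: derivative_eq_intros oscillatorD[OF osc])
  have growth: "- (4 * m) * e s \<le> e' s" for s
  proof -
    have sin: "\<bar>sin (2 * h s)\<bar> \<le> 2 * \<bar>h s\<bar>" using abs_sin_x_le_abs_x[of "2 * h s"] by (simp add: abs_mult)
    have "\<bar>(m - 1) * v s + m / 2 * sin (2 * h s)\<bar> \<le> (m - 1) * \<bar>v s\<bar> + m / 2 * (2 * \<bar>h s\<bar>)"
      using m sin by (intro order_trans[OF abs_triangle_ineq] add_mono) (auto simp: abs_mult)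
    then have "\<bar>T s\<bar> * \<bar>(m - 1) * v s + m / 2 * sin (2 * h s)\<bar> \<le> 1 * ((m - 1) * \<bar>v s\<bar> + m * \<bar>h s\<bar>)"
      using T by (intro mult_mono) auto
    then have "2 * \<bar>v s\<bar> * (\<bar>T s\<bar> * \<bar>(m - 1) * v s + m / 2 * sin (2 * h s)\<bar>)
        \<le> 2 * \<bar>v s\<bar> * ((m - 1) * \<bar>v s\<bar> + m * \<bar>h s\<bar>)"
      by (intro mult_left_mono) auto
    then have "\<bar>e' s\<bar> \<le> 2 * \<bar>h s\<bar> * \<bar>v s\<bar> + 2 * \<bar>v s\<bar> * ((m - 1) * \<bar>v s\<bar> + m * \<bar>h s\<bar>)"
      unfolding e'_def by (intro order_trans[OF abs_triangle_ineq]) (simp add: abs_mult mult.assoc)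
    also have "\<dots> = 2 * (m - 1) * \<bar>v s\<bar>\<^sup>2 + (m + 1) * (2 * \<bar>h s\<bar> * \<bar>v s\<bar>)"
      by (simp add: algebra_simps power2_eq_square)
    also have "\<dots> \<le> 2 * (m - 1) * e s + (m + 1) * e s"
      using m sum_squares_bound[of "\<bar>h s\<bar>" "\<bar>v s\<bar>"]
      by (intro add_mono mult_left_mono) (auto simp: e_def)
    also have "\<dots> \<le> 4 * m * e s"
    proof -
      have "(2 * (m - 1) + (m + 1)) * e s \<le> (4 * m) * e s"
        using m by (intro mult_right_mono) (auto simp: e_def)
      then show ?thesis by (simp only: distrib_right)
    qed
    finally show ?thesis by linarith
  qed
  have "e s * exp (4 * m * s) \<le> e b * exp (4 * m * b)"
  proof (rule DERIV_nonneg_imp_nondecreasing[where f = "\<lambda>s. e s * exp (4 * m * s)", OF s])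
    fix x
    have "((\<lambda>s. e s * exp (4 * m * s)) has_real_derivative (e' x + 4 * m * e x) * exp (4 * m * x)) (at x)"
      by (auto intro!: derivative_eq_intros e simp: algebra_simps)
    moreover have "0 \<le> (e' x + 4 * m * e x) * exp (4 * m * x)" using growth[of x] by simp
    ultimately show "\<exists>y. ((\<lambda>s. e s * exp (4 * m * s)) has_real_derivative y) (at x) \<and> 0 \<le> y" by blast
  qed
  then have "e s * exp (4 * m * s) \<le> 0" using rest by (simp add: e_def)
  then have "e s \<le> 0" by (simp add: mult_le_0_iff)
  then have "(h s)\<^sup>2 \<le> 0" unfolding e_def using zero_le_power2[of "v s"] by linarith
  then show ?thesis by simp
qed

text \<open>A solution of eventually constant sign would first have to decrease towards \<open>0\<close>. The slope
\<open>u = v / h\<close> of the phase vector then satisfies \<open>u' = - (u\<^sup>2 + (m - 1) u + m / 2 * w)\<close> with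
\<open>w = sin (2 h) / h\<close> close to \<open>2\<close>. The quadratic \<open>u\<^sup>2 + (m - 1) u + m\<close> has discriminant
\<open>(m - 1)\<^sup>2 - 4 m\<close>, negative at integers exactly for \<open>1 \<le> m \<le> 5\<close>: this is where the upper bound on
\<open>m\<close> enters. Hence the angle \<open>arctan u\<close> decreases at a uniform rate, which a bounded quantity cannot do.\<close>

lemma autonomous_no_final_sign:
  fixes m :: real
  assumes osc: "oscillator m (\<lambda>_. - 1) h v" and m: "2 \<le> m" "m \<le> 5"
    and trap: "\<And>s. \<bar>h s\<bar> < pi / 2 \<and> (v s)\<^sup>2 < m * (cos (h s))\<^sup>2"
    and pos: "\<And>s. S \<le> s \<Longrightarrow> 0 < h s"
  shows False
proof -
  have v': "(v has_real_derivative - ((m - 1) * v s + m / 2 * sin (2 * h s))) (at s)" for s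
    using oscillatorD(2)[OF osc, of s] by simp
  note h' = oscillatorD(1)[OF osc]
  have sin_pos: "0 < sin (2 * h s)" if "S \<le> s" for s
    using pos[OF that] trap[of s] by (intro sin_gt_zero) auto
  define e where "e s = (v s)\<^sup>2 / 2 + m / 2 * (sin (h s))\<^sup>2" for s
  have e': "(e has_real_derivative - (m - 1) * (v s)\<^sup>2) (at s)" for s
  proof -
    define q where "q = - ((m - 1) * v s + m / 2 * sin (2 * h s))"
    have "(v has_real_derivative q) (at s)" using v' by (simp add: q_def)
    then have "(e has_real_derivative v s * q + m / 2 * (2 * sin (h s) * (cos (h s) * v s))) (at s)"
      unfolding e_def[abs_def] by (auto intro!: derivative_eq_intros h')
    moreover have "v s * q + m / 2 * (2 * sin (h s) * (cos (h s) * v s)) = - (m - 1) * (v s)\<^sup>2"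
      unfolding q_def sin_double by (simp add: algebra_simps power2_eq_square)
    ultimately show ?thesis by (simp only:)
  qed
  \<comment> \<open>Decreasing energy keeps \<open>h\<close> away from \<open>pi / 2\<close>: \<open>\<kappa>\<close> is a lower bound for \<open>cos h\<close>.\<close>
  define \<kappa> where "\<kappa> = sqrt (1 - 2 * e S / m)"
  have "e S < m / 2"
    using trap[of S] by (simp add: e_def sin_squared_eq right_diff_distrib)
  then have \<kappa>: "0 < \<kappa>" "\<kappa>\<^sup>2 = 1 - 2 * e S / m" using m by (auto simp: \<kappa>_def divide_simps)
  have cos_ge: "\<kappa> \<le> cos (h s)" if s: "S \<le> s" for s
  proof -
    have "e s \<le> e S"
    proof (rule DERIV_nonpos_imp_nonincreasing[where f = e, OF s])
      fix x
      have "- (m - 1) * (v x)\<^sup>2 \<le> 0" using m by (intro mult_nonpos_nonneg) auto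
      then show "\<exists>y. (e has_real_derivative y) (at x) \<and> y \<le> 0" using e' by blast
    qed
    moreover have "m / 2 * (1 - (cos (h s))\<^sup>2) \<le> e s" by (simp add: e_def sin_squared_eq)
    ultimately have "1 - (cos (h s))\<^sup>2 \<le> 2 * e S / m" using m by (simp add: field_simps)
    then have "\<kappa>\<^sup>2 \<le> (cos (h s))\<^sup>2" using \<kappa>(2) by linarith
    moreover have "0 \<le> cos (h s)" using trap[of s] by (intro cos_ge_zero) auto
    ultimately show ?thesis by (rule power2_le_imp_le)
  qed
  have drops: "\<exists>s\<ge>S1. h s < l" if l: "0 < l" and S1: "S \<le> S1" for l S1
  proof (rule ccontr)
    assume "\<not> (\<exists>s\<ge>S1. h s < l)"
    then have l_le: "l \<le> h s" if "S1 \<le> s" for s using that by force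
    have l2: "l < pi / 2" using l_le[of S1] trap[of S1] by auto
    define \<delta> where "\<delta> = m * (sin l * \<kappa>)"
    have "0 < sin l" using l l2 by (intro sin_gt_zero) auto
    then have \<delta>: "0 < \<delta>" using m \<kappa>(1) by (simp add: \<delta>_def)
    show False
    proof (rule no_bounded_linear_decrease[where f = "\<lambda>s. v s + (m - 1) * h s" and a = S1 and \<delta> = \<delta> and B = "- m"])
      fix s assume s: "S1 \<le> s"
      show "((\<lambda>s. v s + (m - 1) * h s) has_real_derivative - (m / 2 * sin (2 * h s))) (at s)"
        by (auto intro!: derivative_eq_intros v' h')
      have "sin l \<le> sin (h s)" using l_le[OF s] l trap[of s] by (intro sin_monotone_2pi_le) auto
      then have "sin l * \<kappa> \<le> sin (h s) * cos (h s)"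
        using cos_ge[of s] s S1 \<kappa>(1) \<open>0 < sin l\<close> by (intro mult_mono) auto
      then have "m * (sin l * \<kappa>) \<le> m * (sin (h s) * cos (h s))" using m by (intro mult_left_mono) auto
      then show "- (m / 2 * sin (2 * h s)) \<le> - \<delta>" by (simp add: \<delta>_def sin_double)
      have "(v s)\<^sup>2 \<le> m\<^sup>2"
      proof -
        have "(cos (h s))\<^sup>2 \<le> 1" by (simp add: abs_square_le_1)
        then have "m * (cos (h s))\<^sup>2 \<le> m * m" using m by (intro mult_left_mono) auto
        then show ?thesis using trap[of s] by (simp add: power2_eq_square)
      qed
      then have "- m \<le> v s" using m abs_le_square_iff[of "v s" m] by auto
      moreover have "0 \<le> (m - 1) * h s" using m l l_le[OF s] by simp
      ultimately show "- m \<le> v s + (m - 1) * h s" by simp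
    qed (rule \<delta>)
  qed
  \<comment> \<open>A solution rising for ever would contradict \<open>drops\<close>.\<close>
  have "\<exists>s1\<ge>S. v s1 \<le> 0"
  proof (rule ccontr)
    assume "\<not> (\<exists>s1\<ge>S. v s1 \<le> 0)"
    then have vpos: "0 < v s" if "S \<le> s" for s using that by force
    have "h S \<le> h s" if "S \<le> s" for s
    proof (rule DERIV_nonneg_imp_nondecreasing[where f = h, OF that])
      fix x assume "S \<le> x"
      then show "\<exists>y. (h has_real_derivative y) (at x) \<and> 0 \<le> y" using h' vpos[of x] by force
    qed
    with drops[OF pos[OF order_refl] order_refl] show False by force
  qed
  then obtain s1 where s1: "S \<le> s1" "v s1 \<le> 0" by blast
  have vneg: "v s \<le> 0" if s: "s1 \<le> s" for s
  proof -
    have "v s \<le> max 0 (v s1)"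
    proof (rule nonincreasing_while_pos[where f = v, OF s v'])
      fix x assume "x \<in> {s1..s}" "0 < v x"
      then have "0 < (m - 1) * v x + m / 2 * sin (2 * h x)"
        using m sin_pos[of x] s1(1) by (intro add_pos_pos mult_pos_pos) auto
      then show "- ((m - 1) * v x + m / 2 * sin (2 * h x)) \<le> 0" by simp
    qed
    then show ?thesis using s1(2) by simp
  qed
  \<comment> \<open>Below \<open>1 / 5\<close> the ratio \<open>sin (2 h) / h\<close> is at least \<open>9 / 5\<close>, enough for negative discriminant when \<open>m \<le> 5\<close>.\<close>
  obtain s2 where s2: "s1 \<le> s2" "h s2 < 1 / 5" using drops[of "1 / 5" s1] s1(1) by auto
  have small: "0 < h s" "h s < 1 / 5" if s: "s2 \<le> s" for s
  proof -
    show "0 < h s" using pos s s2 s1 by simp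
    have "h s \<le> h s2"
    proof (rule DERIV_nonpos_imp_nonincreasing[where f = h, OF s])
      fix x assume "s2 \<le> x"
      then show "\<exists>y. (h has_real_derivative y) (at x) \<and> y \<le> 0" using h' vneg[of x] s2(1) by force
    qed
    then show "h s < 1 / 5" using s2(2) by simp
  qed
  show False
  proof (rule no_bounded_linear_decrease[where f = "\<lambda>s. arctan (v s / h s)" and a = s2 and \<delta> = "1 / 50" and B = "- (pi / 2)"])
    fix s assume s: "s2 \<le> s"
    note hs = small[OF s]
    define u where "u = v s / h s"
    define w where "w = sin (2 * h s) / h s"
    have w: "9 / 5 \<le> w"
    proof -
      have "(h s)\<^sup>2 \<le> (1 / 5)\<^sup>2" using hs by (intro power_mono) auto
      have "\<bar>sin (2 * h s) / 2 - h s\<bar> \<le> 2 * (h s)\<^sup>2 * h s"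
        using sin_defect_lipschitz[of "h s" "h s" 0] hs by simp
      also have "\<dots> \<le> 2 * (1 / 5)\<^sup>2 * h s"
        using \<open>(h s)\<^sup>2 \<le> (1 / 5)\<^sup>2\<close> hs by (intro mult_right_mono) auto
      finally have "\<bar>sin (2 * h s) / 2 - h s\<bar> \<le> 2 / 25 * h s" by (simp add: power2_eq_square)
      with abs_ge_minus_self[of "sin (2 * h s) / 2 - h s"]
      have "h s - sin (2 * h s) / 2 \<le> 2 / 25 * h s" by simp
      then have "9 / 5 * h s \<le> sin (2 * h s)" using hs(1) by (simp add: field_simps)
      then show ?thesis using hs by (simp add: w_def le_divide_eq)
    qed
    have "((\<lambda>s. v s / h s) has_real_derivative (- ((m - 1) * v s + m / 2 * sin (2 * h s)) * h s - v s * v s) / (h s * h s)) (at s)"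
      by (rule DERIV_divide[OF v' h']) (use hs in simp)
    moreover have "(- ((m - 1) * v s + m / 2 * sin (2 * h s)) * h s - v s * v s) / (h s * h s)
        = - (u\<^sup>2 + (m - 1) * u + m / 2 * w)"
    proof -
      have vs: "v s = u * h s" and ws: "sin (2 * h s) = w * h s" using hs by (simp_all add: u_def w_def)
      have "- ((m - 1) * v s + m / 2 * sin (2 * h s)) * h s - v s * v s
          = - (u\<^sup>2 + (m - 1) * u + m / 2 * w) * (h s * h s)"
        unfolding vs ws by (simp add: algebra_simps power2_eq_square)
      then show ?thesis using hs by simp
    qed
    ultimately have "((\<lambda>s. v s / h s) has_real_derivative - (u\<^sup>2 + (m - 1) * u + m / 2 * w)) (at s)" by (simp only:)
    from DERIV_chain2[OF DERIV_arctan this]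
    show "((\<lambda>s. arctan (v s / h s)) has_real_derivative inverse (1 + u\<^sup>2) * - (u\<^sup>2 + (m - 1) * u + m / 2 * w)) (at s)"
      by (simp add: u_def)
    show "inverse (1 + u\<^sup>2) * - (u\<^sup>2 + (m - 1) * u + m / 2 * w) \<le> - (1 / 50)"
    proof -
      have "m / 2 * (9 / 5) \<le> m / 2 * w" using w m by (intro mult_left_mono) auto
      moreover have "(1 + u\<^sup>2) / 50 \<le> u\<^sup>2 + (m - 1) * u + 9 / 10 * m"
      proof -
        have "0 \<le> (m - 2) * (5 - m)" using m by simp
        then have "(m - 1)\<^sup>2 \<le> 5 * m - 9" by (simp add: algebra_simps power2_eq_square)
        \<comment> \<open>Completing the square in \<open>49 / 50 * u\<^sup>2 + (m - 1) * u + ...\<close>, after subtracting \<open>(1 + u\<^sup>2) / 50\<close>.\<close>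
        moreover have "0 \<le> (49 / 25 * u + (m - 1))\<^sup>2" by simp
        moreover have "98 / 25 * (49 / 50 * u\<^sup>2 + (m - 1) * u + 9 / 10 * m - 1 / 50)
            = (49 / 25 * u + (m - 1))\<^sup>2 + (98 / 25 * (9 / 10 * m - 1 / 50) - (m - 1)\<^sup>2)"
          by (simp add: power2_eq_square algebra_simps)
        moreover have "5 * m - 9 \<le> 98 / 25 * (9 / 10 * m - 1 / 50)" using m by simp
        ultimately have "0 \<le> 98 / 25 * (49 / 50 * u\<^sup>2 + (m - 1) * u + 9 / 10 * m - 1 / 50)"
          by linarith
        then show ?thesis by (simp add: field_simps)
      qed
      ultimately have "(1 + u\<^sup>2) / 50 \<le> u\<^sup>2 + (m - 1) * u + m / 2 * w" by linarith
      moreover have "0 < 1 + u\<^sup>2" by (intro add_pos_nonneg) auto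
      ultimately have "1 / 50 \<le> (u\<^sup>2 + (m - 1) * u + m / 2 * w) / (1 + u\<^sup>2)"
        by (simp add: le_divide_eq)
      moreover have "inverse (1 + u\<^sup>2) * - (u\<^sup>2 + (m - 1) * u + m / 2 * w)
          = - ((u\<^sup>2 + (m - 1) * u + m / 2 * w) / (1 + u\<^sup>2))"
        by (simp only: divide_inverse mult_minus_right mult.commute)
      ultimately show ?thesis by linarith
    qed
    show "- (pi / 2) \<le> arctan (v s / h s)" using arctan_lbound[of "v s / h s"] by simp
  qed simp
qed

lemma autonomous_zeros:
  fixes m :: real
  assumes osc: "oscillator m (\<lambda>_. - 1) h v" and m: "2 \<le> m" "m \<le> 5"
    and trap: "\<And>s. \<bar>h s\<bar> < pi / 2 \<and> (v s)\<^sup>2 < m * (cos (h s))\<^sup>2"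
  shows "\<exists>s\<ge>S. h s = 0"
proof (rule ccontr)
  assume no: "\<not> (\<exists>s\<ge>S. h s = 0)"
  have cont: "continuous_on {S..s} h" for s by (rule oscillator_cont[OF osc])
  have "0 < h s" if "S \<le> s" "0 < h S" for s
    using IVT2'[of h s 0 S] cont no that by (force simp: not_less)
  moreover have "h s < 0" if "S \<le> s" "h S < 0" for s
    using IVT'[of h S 0 s] cont no that by (force simp: not_less)
  moreover have "h S \<noteq> 0" using no by auto
  ultimately show False
    using autonomous_no_final_sign[OF osc m trap, of S]
      autonomous_no_final_sign[OF oscillator_minus[OF osc] m, of S] trap
    by (metis abs_minus_cancel cos_minus linorder_neqE_linordered_idom neg_0_less_iff_less power2_minus)
qed

section \<open>Escape from the strip after the turning point\<close>

text \<open>An escape is recorded by a moment at which the solution is positive and rising inside the strip,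
and not by its reaching \<open>pi / 2\<close>: strict inequalities on a compact time interval persist
under small changes of the solution.\<close>

definition escapes_up :: "(real \<Rightarrow> real) \<Rightarrow> (real \<Rightarrow> real) \<Rightarrow> bool" where
  "escapes_up h v \<longleftrightarrow> (\<exists>x\<ge>0. 0 < h x \<and> 0 < v x \<and> (\<forall>u\<in>{0..x}. \<bar>h u\<bar> < pi / 2))"

text \<open>For \<open>x \<ge> 0\<close> both the damping and the restoring force have reversed their sign, so that a solution with
\<open>h > 0\<close> and \<open>v > 0\<close> is accelerated until it leaves the strip.\<close>

lemma rising_persists:
  fixes m :: real
  assumes osc: "oscillator m tanh h v" and m: "1 \<le> m" and ab: "0 \<le> a" "a \<le> b"
    and strip: "\<And>u. u \<in> {a..b} \<Longrightarrow> \<bar>h u\<bar> < pi / 2" and start: "0 < h a" "0 < v a"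
  shows "0 < h b" "0 < v b"
proof -
  have vpos: "0 < v x" if x: "x \<in> {a..b}" for x
  proof (rule ccontr)
    assume "\<not> 0 < v x"
    then have "v x \<le> 0" by simp
    obtain z where z: "z \<in> {a..x}" "v z \<le> 0" and before: "\<And>y. y \<in> {a..<z} \<Longrightarrow> 0 < v y"
      by (rule first_sublevel_point[OF oscillator_cont(2)[OF osc] x \<open>v x \<le> 0\<close>]) blast
    have "a < z" using z start(2) by (cases "a = z") auto
    have hpos: "0 < h y" if y: "y \<in> {a..<z}" for y
    proof -
      have "h a \<le> h y"
      proof (rule DERIV_nonneg_imp_nondecreasing[where f = h])
        show "a \<le> y" using y by simp
        fix w assume "a \<le> w" "w \<le> y"
        then have "0 < v w" using y by (intro before) auto
        then show "\<exists>d. (h has_real_derivative d) (at w) \<and> 0 \<le> d" using oscillatorD(1)[OF osc, of w] by auto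
      qed
      then show ?thesis using start(1) by simp
    qed
    obtain w where w: "a < w" "w < z" "v z - v a = (z - a) * (tanh w * ((m - 1) * v w + m / 2 * sin (2 * h w)))"
      using MVT2[OF \<open>a < z\<close>, of v "\<lambda>w. tanh w * ((m - 1) * v w + m / 2 * sin (2 * h w))"]
        oscillatorD(2)[OF osc] by blast
    have w': "w \<in> {a..<z}" "w \<in> {a..b}" using w z x by auto
    have "0 < sin (2 * h w)" using hpos[OF w'(1)] strip[OF w'(2)] by (intro sin_gt_zero) auto
    then have "0 \<le> (m - 1) * v w + m / 2 * sin (2 * h w)"
      using m before[OF w'(1)] by (intro add_nonneg_nonneg mult_nonneg_nonneg) auto
    moreover have "0 \<le> tanh w" using w ab by simp
    ultimately have "0 \<le> v z - v a" using w by simp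
    then show False using z(2) start(2) by simp
  qed
  have "h a \<le> h b"
  proof (rule DERIV_nonneg_imp_nondecreasing[where f = h, OF ab(2)])
    fix w assume "a \<le> w" "w \<le> b"
    then have "0 < v w" by (intro vpos) auto
    then show "\<exists>d. (h has_real_derivative d) (at w) \<and> 0 \<le> d" using oscillatorD(1)[OF osc, of w] by auto
  qed
  then show "0 < h b" using start(1) by simp
  show "0 < v b" using vpos ab by simp
qed

lemma escapes_exclusive:
  fixes m :: real
  assumes osc: "oscillator m tanh h v" and m: "1 \<le> m"
  shows "\<not> (escapes_up h v \<and> escapes_up (\<lambda>x. - h x) (\<lambda>x. - v x))"
proof
  assume "escapes_up h v \<and> escapes_up (\<lambda>x. - h x) (\<lambda>x. - v x)"
  then obtain x y where x: "0 \<le> x" "0 < h x" "0 < v x" "\<And>u. u \<in> {0..x} \<Longrightarrow> \<bar>h u\<bar> < pi / 2"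
    and y: "0 \<le> y" "0 < - h y" "0 < - v y" "\<And>u. u \<in> {0..y} \<Longrightarrow> \<bar>- h u\<bar> < pi / 2"
    unfolding escapes_up_def by blast
  show False
  proof (cases "x \<le> y")
    case True
    have "0 < h y"
      by (rule rising_persists(1)[OF osc m x(1) True _ x(2,3)]) (use y(4) x(1) in force)
    then show False using y(2) by simp
  next
    case False
    then have "y \<le> x" by simp
    have "0 < - h x"
      by (rule rising_persists(1)[OF oscillator_minus[OF osc] m y(1) \<open>y \<le> x\<close> _ y(2,3)]) (use x(4) y(1) in force)
    then show False using x(2) by simp
  qed
qed

lemma exit_at_top_escapes:
  fixes m :: real
  assumes osc: "oscillator m tanh h v" and strip0: "\<bar>h 0\<bar> < pi / 2"
    and exit: "0 \<le> x1" "h x1 = pi / 2" and before: "\<And>u. u \<in> {0..<x1} \<Longrightarrow> \<bar>h u\<bar> < pi / 2"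
  shows "escapes_up h v"
proof -
  have "0 < x1" using exit strip0 by (cases "x1 = 0") auto
  obtain y where y: "y \<in> {0..<x1}" "\<And>z. z \<in> {y<..x1} \<Longrightarrow> 0 < h z"
  proof (cases "h 0 \<le> 0")
    case True
    have "0 \<in> {0..x1}" using \<open>0 < x1\<close> by simp
    obtain z where z: "z \<in> {0..x1}" "h z \<le> 0" "\<And>y. y \<in> {z<..x1} \<Longrightarrow> 0 < h y"
      by (rule last_sublevel_point[OF oscillator_cont(1)[OF osc] \<open>0 \<in> {0..x1}\<close> True]) blast
    have "h z < h x1" using z(2) exit(2) pi_gt_zero by linarith
    then have "z \<noteq> x1" by auto
    then show ?thesis using z by (intro that[of z]) auto
  next
    case False
    show ?thesis
    proof (cases "\<exists>x\<in>{0..x1}. h x \<le> 0")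
      case True
      then obtain x where x: "x \<in> {0..x1}" "h x \<le> 0" by blast
      obtain z where z: "z \<in> {x..x1}" "h z \<le> 0" "\<And>y. y \<in> {z<..x1} \<Longrightarrow> 0 < h y"
        by (rule last_sublevel_point[OF oscillator_cont(1)[OF osc] x]) blast
      have "h z < h x1" using z(2) exit(2) pi_gt_zero by linarith
    then have "z \<noteq> x1" by auto
      then show ?thesis using z x by (intro that[of z]) auto
    next
      case False
      then show ?thesis using \<open>0 < x1\<close> by (intro that[of 0]) (auto intro!: not_le_imp_less)
    qed
  qed
  have "y < x1" using y(1) by simp
  then obtain z where z: "y < z" "z < x1" "h x1 - h y = (x1 - y) * v z"
    using MVT2[OF \<open>y < x1\<close>, of h v] oscillatorD(1)[OF osc] by blast
  have "h y < pi / 2" using before[OF y(1)] by simp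
  then have "0 < (x1 - y) * v z" using z(3) exit(2) by simp
  then have "0 < v z" using \<open>y < x1\<close> by (simp add: zero_less_mult_iff)
  moreover have "0 < h z" using z by (intro y(2)) auto
  moreover have "\<forall>u\<in>{0..z}. \<bar>h u\<bar> < pi / 2" using z(2) before by (metis atLeastAtMost_iff atLeastLessThan_iff le_less_trans)
  moreover have "0 \<le> z" using y(1) z(1) by simp
  ultimately show ?thesis unfolding escapes_up_def by blast
qed

lemma no_escape_strip:
  fixes m :: real
  assumes osc: "oscillator m tanh h v" and strip0: "\<bar>h 0\<bar> < pi / 2"
    and up: "\<not> escapes_up h v" and down: "\<not> escapes_up (\<lambda>x. - h x) (\<lambda>x. - v x)" and x: "0 \<le> x"
  shows "\<bar>h x\<bar> < pi / 2"
proof (rule ccontr)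
  assume "\<not> \<bar>h x\<bar> < pi / 2"
  then have x': "x \<in> {0..x}" "- \<bar>h x\<bar> \<le> - (pi / 2)" using x by auto
  have cont: "continuous_on {0..x} (\<lambda>x. - \<bar>h x\<bar>)"
    by (intro continuous_intros oscillator_cont[OF osc])
  obtain x1 where x1: "x1 \<in> {0..x}" "- \<bar>h x1\<bar> \<le> - (pi / 2)" "\<And>y. y \<in> {0..<x1} \<Longrightarrow> - (pi / 2) < - \<bar>h y\<bar>"
    by (rule first_sublevel_point[OF cont x']) blast
  have before: "\<bar>h y\<bar> < pi / 2" if "y \<in> {0..<x1}" for y using x1(3)[OF that] by simp
  have "x1 \<noteq> 0" using x1(2) strip0 by auto
  have "\<bar>h x1\<bar> = pi / 2"
  proof (rule antisym)
    show "pi / 2 \<le> \<bar>h x1\<bar>" using x1(2) by simp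
    obtain z where "0 \<le> z" "z \<le> x1" "\<bar>h z\<bar> = pi / 2"
      using IVT'[of "\<lambda>x. \<bar>h x\<bar>" 0 "pi / 2" x1] strip0 x1
      by (auto intro!: continuous_intros oscillator_cont[OF osc])
    then show "\<bar>h x1\<bar> \<le> pi / 2" using before[of z] by (cases "z = x1") auto
  qed
  then consider "h x1 = pi / 2" | "- h x1 = pi / 2" by linarith
  then show False
  proof cases
    case 1
    then show False using exit_at_top_escapes[OF osc strip0 _ 1 before] x1(1) up by auto
  next
    case 2
    then show False using exit_at_top_escapes[OF oscillator_minus[OF osc] _ _ 2] x1(1) strip0 before down by auto
  qed
qed

lemma upward_zero_escapes:
  fixes m :: real
  assumes osc: "oscillator m T h v" and zero: "h x = 0" "0 < v x"
  shows "\<exists>y>x. 0 < h y \<and> 0 < v y"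
proof -
  obtain d where d: "0 < d" "\<And>e. 0 < e \<Longrightarrow> e < d \<Longrightarrow> h x < h (x + e)"
    using DERIV_pos_inc_right[OF oscillatorD(1)[OF osc] zero(2)] by blast
  have "isCont v x" using oscillatorD(2)[OF osc] by (rule DERIV_isCont)
  then have "\<forall>\<^sub>F y in at x. 0 < v y"
    using zero(2) by (intro order_tendstoD(1)) (auto simp: isCont_def)
  then obtain d' where d': "0 < d'" "\<And>y. y \<noteq> x \<Longrightarrow> dist y x < d' \<Longrightarrow> 0 < v y"
    unfolding eventually_at by auto
  define e where "e = min d d' / 2"
  have e: "0 < e" "e < d" "e < d'" using d(1) d'(1) by (auto simp: e_def)
  have "0 < h (x + e)" using d(2)[OF e(1,2)] zero(1) by simp
  moreover have "0 < v (x + e)" using e by (intro d'(2)) (auto simp: dist_real_def)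
  ultimately show ?thesis using e(1) by (intro exI[of _ "x + e"]) auto
qed

text \<open>A limit \<open>l > 0\<close> is impossible because the force would stay bounded away from \<open>0\<close> and drive
\<open>(m - 1) * h - v\<close>, which is nonnegative, down at a uniform rate.\<close>

lemma trapped_positive_tendsto_0:
  fixes m :: real
  assumes osc: "oscillator m tanh h v" and m: "1 \<le> m"
    and strip: "\<And>x. 0 \<le> x \<Longrightarrow> \<bar>h x\<bar> < pi / 2" and pos: "\<And>x. 0 \<le> x \<Longrightarrow> 0 < h x"
    and vneg: "\<And>x. 0 \<le> x \<Longrightarrow> v x \<le> 0"
  shows "(h \<longlongrightarrow> 0) at_top"
proof -
  have anti: "h y \<le> h x" if "0 \<le> x" "x \<le> y" for x y
  proof (rule DERIV_nonpos_imp_nonincreasing[where f = h, OF that(2)])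
    fix w assume "x \<le> w"
    then show "\<exists>d. (h has_real_derivative d) (at w) \<and> d \<le> 0"
      using oscillatorD(1)[OF osc, of w] vneg[of w] that(1) by auto
  qed
  have small: "\<exists>x\<ge>0. h x < l" if l: "0 < l" for l
  proof (rule ccontr)
    assume "\<not> (\<exists>x\<ge>0. h x < l)"
    then have l_le: "l \<le> h x" if "0 \<le> x" for x using that by force
    have l2: "l < pi / 2" using l_le[of 0] strip[of 0] by auto
    have "0 < sin l" using l l2 by (intro sin_gt_zero) auto
    moreover have "0 < cos (h 0)" using strip[of 0] by (intro cos_gt_zero_pi) auto
    moreover have t1: "0 < tanh (1::real)" by simp
    ultimately have \<delta>: "0 < tanh 1 * (m * (sin l * cos (h 0)))" using m by (intro mult_pos_pos) auto
    show False
    proof (rule no_bounded_linear_decrease[where f = "\<lambda>x. (m - 1) * h x - v x" and a = 1 and B = 0, OF _ _ \<delta>])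
      fix x :: real assume "1 \<le> x"
      then have x: "0 \<le> x" "1 \<le> x" by auto
      show "((\<lambda>x. (m - 1) * h x - v x) has_real_derivative
          (m - 1) * v x - tanh x * ((m - 1) * v x + m / 2 * sin (2 * h x))) (at x)"
        by (auto intro!: derivative_eq_intros oscillatorD[OF osc])
      have "sin l \<le> sin (h x)" using l_le[OF x(1)] l strip[OF x(1)] by (intro sin_monotone_2pi_le) auto
      moreover have "cos (h 0) \<le> cos (h x)"
        using anti[of 0 x] x pos[OF x(1)] strip[of 0] by (intro cos_monotone_0_pi_le) auto
      ultimately have "sin l * cos (h 0) \<le> sin (h x) * cos (h x)"
        using \<open>0 < sin l\<close> \<open>0 < cos (h 0)\<close> by (intro mult_mono) auto
      then have "tanh 1 * (m * (sin l * cos (h 0))) \<le> tanh x * (m * (sin (h x) * cos (h x)))"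
        by (intro mult_mono[OF _ mult_left_mono]) (use m x t1 \<open>0 < sin l\<close> \<open>0 < cos (h 0)\<close> in auto)
      moreover have "(1 - tanh x) * ((m - 1) * v x) \<le> 0"
        using tanh_real_lt_1[of x] m vneg[OF x(1)] by (intro mult_nonneg_nonpos) auto
      ultimately show "(m - 1) * v x - tanh x * ((m - 1) * v x + m / 2 * sin (2 * h x))
          \<le> - (tanh 1 * (m * (sin l * cos (h 0))))"
        unfolding sin_double by (simp add: algebra_simps)
      have "0 \<le> (m - 1) * h x" using m pos[OF x(1)] by simp
      then show "0 \<le> (m - 1) * h x - v x" using vneg[OF x(1)] by linarith
    qed
  qed
  show ?thesis
  proof (rule tendstoI)
    fix l :: real assume "0 < l"
    then obtain x0 where x0: "0 \<le> x0" "h x0 < l" using small by blast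
    show "\<forall>\<^sub>F x in at_top. dist (h x) 0 < l"
      using eventually_ge_at_top[of x0]
    proof eventually_elim
      case (elim x)
      then show ?case using anti[of x0 x] pos[of x] x0 by simp
    qed
  qed
qed

text \<open>A solution that escapes in neither direction cannot cross \<open>0\<close>, since it would be rising above or
falling below \<open>0\<close> right afterwards. So it has a fixed sign and moves monotonically towards \<open>0\<close>.\<close>

lemma no_escape_tendsto_0:
  fixes m :: real
  assumes osc: "oscillator m tanh h v" and m: "1 \<le> m" and strip0: "\<bar>h 0\<bar> < pi / 2"
    and up: "\<not> escapes_up h v" and down: "\<not> escapes_up (\<lambda>x. - h x) (\<lambda>x. - v x)"
    and moving: "\<And>x. h x \<noteq> 0 \<or> v x \<noteq> 0"
  shows "(h \<longlongrightarrow> 0) at_top"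
proof -
  note strip = no_escape_strip[OF osc strip0 up down]
  have not_up: "\<not> (0 < h x \<and> 0 < v x)" if "0 \<le> x" for x
    using up that strip unfolding escapes_up_def by auto
  have not_down: "\<not> (h x < 0 \<and> v x < 0)" if "0 \<le> x" for x
    using down that strip unfolding escapes_up_def by auto
  have nz: "h x \<noteq> 0" if x: "0 \<le> x" for x
  proof
    assume hx: "h x = 0"
    with moving[of x] consider "0 < v x" | "0 < - v x" by linarith
    then show False
    proof cases
      case 1
      then obtain y where "x < y" "0 < h y" "0 < v y" using upward_zero_escapes[OF osc hx] by blast
      then show False using not_up[of y] x by simp
    next
      case 2
      then obtain y where "x < y" "0 < - h y" "0 < - v y"
        using upward_zero_escapes[OF oscillator_minus[OF osc], of x] hx by auto
      then show False using not_down[of y] x by simp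
    qed
  qed
  have cont: "continuous_on {0..x} h" for x by (rule oscillator_cont[OF osc])
  show ?thesis
  proof (cases "0 < h 0")
    case True
    have pos: "0 < h x" if x: "0 \<le> x" for x
    proof (rule ccontr)
      assume "\<not> 0 < h x"
      then obtain z where "0 \<le> z" "h z = 0" using IVT2'[of h x 0 0] True x cont by auto
      then show False using nz by blast
    qed
    show ?thesis
      by (rule trapped_positive_tendsto_0[OF osc m strip pos]) (use not_up pos in force)+
  next
    case False
    have neg: "0 < - h x" if x: "0 \<le> x" for x
    proof (rule ccontr)
      assume "\<not> 0 < - h x"
      then obtain z where "0 \<le> z" "h z = 0" using IVT'[of h 0 0 x] False x cont by auto
      then show False using nz by blast
    qed
    have "((\<lambda>x. - h x) \<longlongrightarrow> 0) at_top"
      by (rule trapped_positive_tendsto_0[OF oscillator_minus[OF osc] m]) (use not_down neg strip in force)+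
    then show ?thesis using tendsto_minus_cancel[of h 0 at_top] by simp
  qed
qed

section \<open>Shooting with the phase angle\<close>

text \<open>This is the imaginary part of a continuous logarithm of \<open>a + i b\<close>, which exists because a normed
space is contractible.\<close>

lemma continuous_polar_lift:
  fixes a b :: "'a::real_normed_vector \<Rightarrow> real"
  assumes a: "continuous_on UNIV a" and b: "continuous_on UNIV b" and nz: "\<And>p. a p \<noteq> 0 \<or> b p \<noteq> 0"
  shows "\<exists>R \<theta>. continuous_on UNIV \<theta> \<and> (\<forall>p. 0 < R p \<and> a p = R p * cos (\<theta> p) \<and> b p = R p * sin (\<theta> p))"
proof -
  have "continuous_on UNIV (\<lambda>p. Complex (a p) (b p))"
    unfolding Complex_eq by (intro continuous_intros a b)
  moreover have "Complex (a p) (b p) \<noteq> 0" for p using nz by (auto simp: complex_eq_iff)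
  moreover have "contractible (UNIV :: 'a set)" by (rule convex_imp_contractible[OF convex_UNIV])
  ultimately obtain g where g: "continuous_on UNIV g" "\<And>p. Complex (a p) (b p) = exp (g p)"
    using continuous_logarithm_on_contractible[of UNIV "\<lambda>p. Complex (a p) (b p)"] by auto
  show ?thesis
  proof (rule exI[of _ "\<lambda>p. exp (Re (g p))"], rule exI[of _ "\<lambda>p. Im (g p)"], intro conjI allI)
    show "continuous_on UNIV (\<lambda>p. Im (g p))" by (intro continuous_intros g(1))
    fix p
    show "a p = exp (Re (g p)) * cos (Im (g p))" "b p = exp (Re (g p)) * sin (Im (g p))"
      using arg_cong[OF g(2)[of p], of Re] arg_cong[OF g(2)[of p], of Im] by (auto simp: Re_exp Im_exp)
  qed simp
qed

text \<open>When \<open>h\<close> vanishes the phase vector \<open>(h, v)\<close> is vertical and \<open>h' = v\<close> turns it clockwise.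
The levels with \<open>cos \<alpha> = 0\<close> are therefore crossed downwards only.\<close>

lemma angle_crosses_down:
  fixes h v \<theta> R :: "real \<Rightarrow> real"
  assumes h: "\<And>s. (h has_real_derivative v s) (at s)" and \<theta>: "continuous_on UNIV \<theta>"
    and polar: "\<And>s. 0 < R s \<and> h s = R s * cos (\<theta> s) \<and> v s = R s * sin (\<theta> s)"
    and \<alpha>: "cos \<alpha> = 0" and s: "\<theta> s \<le> \<alpha>" "s < t"
  shows "\<theta> t < \<alpha>"
proof -
  have sin2: "sin \<alpha> * sin \<alpha> = 1" using \<alpha> sin_cos_squared_add[of \<alpha>] by (simp add: power2_eq_square)
  have key: "h u * sin \<alpha> = - R u * sin (\<theta> u - \<alpha>)" for u
  proof -
    have "cos (\<theta> u) = cos ((\<theta> u - \<alpha>) + \<alpha>)" by simp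
    also have "\<dots> = - sin (\<theta> u - \<alpha>) * sin \<alpha>" unfolding cos_add \<alpha> by simp
    finally show ?thesis using polar[of u] sin2 by (simp add: mult.assoc)
  qed
  have near: "\<exists>d>0. (\<forall>u. c < u \<and> u < c + d \<longrightarrow> \<theta> u < \<alpha>) \<and> (\<forall>u. c - d < u \<and> u < c \<longrightarrow> \<alpha> < \<theta> u)"
    if c: "\<theta> c = \<alpha>" for c
  proof -
    have "((\<lambda>u. h u * sin \<alpha>) has_real_derivative v c * sin \<alpha>) (at c)"
      by (auto intro!: derivative_eq_intros h)
    moreover have "0 < v c * sin \<alpha>" using polar[of c] c sin2 by (simp add: mult.assoc)
    moreover have hc: "h c * sin \<alpha> = 0" using key[of c] c by simp
    ultimately obtain d1 d2 where d1: "0 < d1" "\<And>e. 0 < e \<Longrightarrow> e < d1 \<Longrightarrow> 0 < h (c + e) * sin \<alpha>"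
      and d2: "0 < d2" "\<And>e. 0 < e \<Longrightarrow> e < d2 \<Longrightarrow> h (c - e) * sin \<alpha> < 0"
      using DERIV_pos_inc_right[of "\<lambda>u. h u * sin \<alpha>" "v c * sin \<alpha>" c]
        DERIV_pos_inc_left[of "\<lambda>u. h u * sin \<alpha>" "v c * sin \<alpha>" c] by (metis (no_types, lifting))
    have "isCont \<theta> c" using \<theta> by (simp add: continuous_on_eq_continuous_at)
    then obtain d3 where d3: "0 < d3" "\<And>u. \<bar>u - c\<bar> < d3 \<Longrightarrow> \<bar>\<theta> u - \<alpha>\<bar> < pi"
      using c pi_gt_zero unfolding continuous_at_eps_delta dist_real_def by blast
    define d where "d = min d1 (min d2 d3)"
    show ?thesis
    proof (rule exI[of _ d], intro conjI allI impI)
      show "0 < d" using d1(1) d2(1) d3(1) by (simp add: d_def)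
      fix u
      {
        assume u: "c < u \<and> u < c + d"
        then have "0 < h u * sin \<alpha>" using d1(2)[of "u - c"] unfolding d_def by auto
        then have "sin (\<theta> u - \<alpha>) < 0" using polar[of u] unfolding key by (simp add: mult_less_0_iff)
        moreover have "\<bar>\<theta> u - \<alpha>\<bar> < pi" using u by (intro d3(2)) (auto simp: d_def)
        ultimately show "\<theta> u < \<alpha>" using sin_ge_zero[of "\<theta> u - \<alpha>"] by (rule_tac ccontr) auto
      next
        assume u: "c - d < u \<and> u < c"
        then have "h u * sin \<alpha> < 0" using d2(2)[of "c - u"] unfolding d_def by auto
        then have "0 < sin (\<theta> u - \<alpha>)" using polar[of u] unfolding key by (simp add: zero_less_mult_iff)
        then have "\<not> 0 \<le> sin (\<alpha> - \<theta> u)" using sin_minus[of "\<theta> u - \<alpha>"] by simp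
        moreover have "\<bar>\<theta> u - \<alpha>\<bar> < pi" using u by (intro d3(2)) (auto simp: d_def)
        ultimately show "\<alpha> < \<theta> u" using sin_ge_zero[of "\<alpha> - \<theta> u"] by (rule_tac ccontr) auto
      }
    qed
  qed
  obtain s' where s': "s \<le> s'" "s' < t" "\<theta> s' < \<alpha>"
  proof (cases "\<theta> s = \<alpha>")
    case True
    then obtain d where "0 < d" "\<And>u. s < u \<Longrightarrow> u < s + d \<Longrightarrow> \<theta> u < \<alpha>" using near by blast
    then show ?thesis using s(2) by (intro that[of "s + min d (t - s) / 2"]) (auto simp: min_def field_simps)
  next
    case False
    then show ?thesis using s by (intro that[of s]) auto
  qed
  show ?thesis
  proof (rule ccontr)
    assume "\<not> \<theta> t < \<alpha>"
    then have t: "t \<in> {s'..t}" "- \<theta> t \<le> - \<alpha>" using s' by auto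
    have cont: "continuous_on {s'..t} (\<lambda>u. - \<theta> u)"
      using \<theta> by (intro continuous_intros) (auto elim: continuous_on_subset)
    obtain z where z: "z \<in> {s'..t}" "- \<theta> z \<le> - \<alpha>" "\<And>y. y \<in> {s'..<z} \<Longrightarrow> - \<alpha> < - \<theta> y"
      by (rule first_sublevel_point[OF cont t]) blast
    have "s' < z" using z(1,2) s'(3) by (cases "s' = z") auto
    obtain w where w: "s' \<le> w" "w \<le> z" "\<theta> w = \<alpha>"
      using IVT'[of \<theta> s' \<alpha> z] s'(3) z \<open>s' < z\<close> \<theta> continuous_on_subset by (metis less_imp_le neg_le_iff_le subset_UNIV)
    have "w = z" using z(3)[of w] w by (cases "w = z") auto
    then obtain d where d: "0 < d" "\<And>u. z - d < u \<Longrightarrow> u < z \<Longrightarrow> \<alpha> < \<theta> u" using near[of z] w by blast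
    define u where "u = max s' (z - d / 2)"
    have u: "z - d < u" "u < z" "u \<in> {s'..<z}" using d(1) \<open>s' < z\<close> by (auto simp: u_def)
    then show False using d(2)[OF u(1,2)] z(3)[OF u(3)] by simp
  qed
qed

text \<open>The time interval in \<open>escapes_up\<close> is compact, so the condition on it is open by the closedness of projections
along compact factors.\<close>

lemma open_escapes_up:
  fixes a b :: "real \<times> real \<Rightarrow> real"
  assumes a: "continuous_on UNIV a" and b: "continuous_on UNIV b"
  shows "open {L. escapes_up (\<lambda>x. a (x, L)) (\<lambda>x. b (x, L))}"
proof -
  have slice: "continuous_on UNIV (\<lambda>L. f (x, L))" if "continuous_on UNIV f" for f :: "real \<times> real \<Rightarrow> real" and x
    by (rule continuous_on_compose2[OF that]) (auto intro!: continuous_intros)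
  have op: "open {L. 0 < f (x, L)}" if "continuous_on UNIV f" for f :: "real \<times> real \<Rightarrow> real" and x
    by (intro open_Collect_less continuous_on_const slice that)
  have strip: "open {L. \<forall>u\<in>{0..x}. \<bar>a (u, L)\<bar> < pi / 2}" for x
  proof -
    have "closed {p. pi / 2 \<le> \<bar>a p\<bar>}" by (intro closed_Collect_le continuous_intros a)
    then have "closed {L. \<exists>u. u \<in> {0..x} \<and> (u, L) \<in> {p. pi / 2 \<le> \<bar>a p\<bar>}}"
      by (intro closed_compact_projection) auto
    moreover have "{L. \<forall>u\<in>{0..x}. \<bar>a (u, L)\<bar> < pi / 2} = - {L. \<exists>u. u \<in> {0..x} \<and> (u, L) \<in> {p. pi / 2 \<le> \<bar>a p\<bar>}}"
      by (fastforce simp: not_le)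
    ultimately show ?thesis by (simp add: open_Compl)
  qed
  have "{L. escapes_up (\<lambda>x. a (x, L)) (\<lambda>x. b (x, L))} =
      (\<Union>x\<in>{0..}. {L. 0 < a (x, L)} \<inter> {L. 0 < b (x, L)} \<inter> {L. \<forall>u\<in>{0..x}. \<bar>a (u, L)\<bar> < pi / 2})"
    unfolding escapes_up_def by auto
  also have "open \<dots>" by (intro open_UN ballI open_Int op strip a b)
  finally show ?thesis .
qed

text \<open>To first order \<open>w\<close> and \<open>sin \<rho>\<close> are both equal to \<open>y\<close>, and \<open>m * \<tau>\<close> is nearly \<open>2\<close> or larger. The
unstable manifold thus starts below the energy level of the saddle.\<close>

lemma energy_inequality_near_saddle:
  fixes y :: real
  assumes y: "0 < y" "y \<le> 1 / 100" and \<rho>: "\<bar>\<rho> - y\<bar> \<le> y\<^sup>2" and w: "\<bar>w - y\<bar> \<le> 2 * y\<^sup>2"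
    and m: "2 \<le> m" and \<tau>: "99 / 100 \<le> \<tau>"
  shows "0 < \<rho>" "\<rho> < 1" "w\<^sup>2 < m * \<tau> * (sin \<rho>)\<^sup>2"
proof -
  have y2: "y\<^sup>2 \<le> y / 100" using y mult_left_mono[of y "1 / 100" y] by (simp add: power2_eq_square)
  have r: "99 / 100 * y \<le> \<rho>" "\<rho> \<le> 101 / 100 * y" using \<rho> y2 by linarith+
  then show "0 < \<rho>" "\<rho> < 1" using y by linarith+
  have ww: "w \<le> 102 / 100 * y" "0 \<le> w" using w y2 y by linarith+
  have sin: "98 / 100 * y \<le> sin \<rho>"
  proof -
    have "\<bar>sin (2 * (\<rho> / 2)) / 2 - \<rho> / 2\<bar> \<le> 2 * (\<rho> / 2)\<^sup>2 * \<bar>\<rho> / 2\<bar>"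
      using sin_defect_lipschitz[of "\<rho> / 2" "\<rho> / 2" 0] \<open>0 < \<rho>\<close> by simp
    also have "\<dots> \<le> 2 * (1 / 100)\<^sup>2 * \<bar>\<rho> / 2\<bar>"
      using r y by (intro mult_right_mono mult_left_mono power_mono) auto
    also have "\<dots> = \<rho> / 10000" using \<open>0 < \<rho>\<close> by (simp add: power2_eq_square)
    finally have "\<rho> / 2 - sin (2 * (\<rho> / 2)) / 2 \<le> \<rho> / 10000" by linarith
    then show ?thesis using r y by simp
  qed
  have "w\<^sup>2 \<le> (102 / 100 * y)\<^sup>2" using ww by (intro power_mono)
  also have "\<dots> < 2 * (99 / 100) * (98 / 100 * y)\<^sup>2" using y by (simp add: power_mult_distrib power2_eq_square)
  also have "\<dots> \<le> m * \<tau> * (sin \<rho>)\<^sup>2"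
    using m \<tau> sin y by (intro mult_mono power_mono) auto
  finally show "w\<^sup>2 < m * \<tau> * (sin \<rho>)\<^sup>2" .
qed

text \<open>The parameter is clipped to \<open>{0..1}\<close>, which makes all families defined and continuous on the
whole plane.\<close>

definition clip :: "real \<Rightarrow> real" where "clip e = max 0 (min 1 e)"

text \<open>For \<open>e = exp (- 2 L)\<close> with \<open>L \<ge> 0\<close> this is \<open>tanh (s - L)\<close>, and for \<open>e = 0\<close> its limit \<open>- 1\<close> as
\<open>L\<close> grows. In this form the limit is an ordinary value of the parameter.\<close>

definition damping :: "real \<Rightarrow> real \<Rightarrow> real" where
  "damping e s = (clip e * exp (2 * s) - 1) / (clip e * exp (2 * s) + 1)"

lemma clip_props: "0 \<le> clip e" "clip e \<le> 1" "continuous_on UNIV clip"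
  by (auto simp: clip_def[abs_def] intro!: continuous_intros)

lemma damping_bound: "\<bar>damping e s\<bar> \<le> 1"
proof -
  have "0 \<le> clip e * exp (2 * s)" using clip_props(1)[of e] by simp
  then show ?thesis by (simp add: damping_def abs_le_iff divide_le_eq le_divide_eq minus_divide_left)
qed

lemma damping_0: "damping 0 = (\<lambda>s. - 1)"
  by (simp add: damping_def[abs_def] clip_def)

lemma damping_shift: "0 \<le> L \<Longrightarrow> damping (exp (- 2 * L)) (x + L) = tanh x"
proof -
  assume L: "0 \<le> L"
  then have "clip (exp (- 2 * L)) * exp (2 * (x + L)) = exp (2 * x)"
    by (simp add: clip_def algebra_simps flip: exp_add)
  then have "damping (exp (- 2 * L)) (x + L) = (exp (2 * x) - 1) / (exp (2 * x) + 1)"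
    by (simp only: damping_def)
  also have "\<dots> = tanh x"
  proof -
    define E where "E = exp (2 * x)"
    have "0 < E" by (simp add: E_def)
    moreover have "tanh x = (1 - inverse E) / (1 + inverse E)"
      by (simp add: tanh_real_altdef E_def exp_minus)
    moreover have "1 - inverse E = (E - 1) / E" "1 + inverse E = (E + 1) / E"
      using \<open>0 < E\<close> by (simp_all add: field_simps)
    ultimately show ?thesis unfolding E_def[symmetric] by simp
  qed
  finally show ?thesis .
qed

lemma early_in_strip:
  fixes h v :: "real \<Rightarrow> real \<Rightarrow> real"
  assumes m: "2 \<le> m" and S: "\<And>s e. s \<le> S \<Longrightarrow> \<bar>h s e + pi / 2 - exp s\<bar> \<le> exp (2 * s) \<and> \<bar>v s e - exp s\<bar> \<le> 2 * exp (2 * s)"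
    and s: "s \<le> min S (ln (1 / 100))"
  shows "\<bar>h s e\<bar> < pi / 2" "h s e < 0" "(v s e)\<^sup>2 < m * (- damping e s) * (cos (h s e))\<^sup>2"
proof -
  have y: "0 < exp s" "exp s \<le> 1 / 100"
  proof -
    have "exp s \<le> exp (ln (1 / 100))" using s by (simp only: exp_le_cancel_iff)
    then show "exp s \<le> 1 / 100" by simp
  qed simp
  have e2: "exp (2 * s) = (exp s)\<^sup>2" by (rule exp_double)
  have \<tau>: "99 / 100 \<le> - damping e s"
  proof -
    define q where "q = clip e * exp (2 * s)"
    have q: "0 \<le> q" using clip_props(1) by (simp add: q_def)
    have "q \<le> 1 * (1 / 100)\<^sup>2"
      unfolding q_def e2 using y by (intro mult_mono power_mono clip_props) auto
    then have "99 / 100 * (q + 1) \<le> 1 - q" by (simp add: power2_eq_square)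
    then have "99 / 100 \<le> (1 - q) / (q + 1)" using q by (simp add: le_divide_eq)
    then show ?thesis unfolding damping_def q_def[symmetric] by (simp only: minus_divide_left minus_diff_eq)
  qed
  have "\<bar>h s e + pi / 2 - exp s\<bar> \<le> (exp s)\<^sup>2" "\<bar>v s e - exp s\<bar> \<le> 2 * (exp s)\<^sup>2"
    using S[of s e] s unfolding e2 by auto
  note L = energy_inequality_near_saddle[OF y this m \<tau>]
  show "\<bar>h s e\<bar> < pi / 2" "h s e < 0" using L(1,2) pi_gt3 by linarith+
  have "sin (h s e + pi / 2) = cos (h s e)" by (simp add: sin_add)
  then show "(v s e)\<^sup>2 < m * (- damping e s) * (cos (h s e))\<^sup>2" using L(3) by simp
qed

text \<open>Every zero of \<open>cos \<theta>\<close> costs the angle another step of \<open>pi\<close>, since no level can be reached twice.\<close>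

lemma angle_unbounded_below:
  fixes \<theta> :: "real \<Rightarrow> real"
  assumes cross: "\<And>s t \<alpha>. cos \<alpha> = 0 \<Longrightarrow> \<theta> s \<le> \<alpha> \<Longrightarrow> s < t \<Longrightarrow> \<theta> t < \<alpha>"
    and zeros: "\<And>S. \<exists>s\<ge>S. cos (\<theta> s) = 0"
  shows "\<exists>s. \<theta> s < B"
proof -
  obtain N :: int where N: "\<theta> 0 \<le> of_int N * pi + pi / 2"
  proof (rule that[of "\<lceil>\<theta> 0 / pi\<rceil>"])
    have "\<theta> 0 / pi * pi \<le> of_int \<lceil>\<theta> 0 / pi\<rceil> * pi" by (intro mult_right_mono) auto
    then have "\<theta> 0 \<le> of_int \<lceil>\<theta> 0 / pi\<rceil> * pi" by simp
    then show "\<theta> 0 \<le> of_int \<lceil>\<theta> 0 / pi\<rceil> * pi + pi / 2"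
      by (intro add_increasing2) auto
  qed
  have cosz: "cos (of_int i * pi + pi / 2) = 0" for i :: int by (auto simp: cos_zero_iff_int2)
  have steps: "\<exists>s. \<theta> s \<le> of_int (N - int n) * pi + pi / 2" for n
  proof (induction n)
    case 0
    then show ?case using N by auto
  next
    case (Suc n)
    then obtain s where s: "\<theta> s \<le> of_int (N - int n) * pi + pi / 2" by blast
    obtain t where t: "t \<ge> s + 1" "cos (\<theta> t) = 0" using zeros by blast
    then obtain i :: int where i: "\<theta> t = of_int i * pi + pi / 2" by (auto simp: cos_zero_iff_int2)
    have "\<theta> t < of_int (N - int n) * pi + pi / 2" using t by (intro cross[OF cosz s]) auto
    then have "of_int i * pi < of_int (N - int n) * pi" using i by simp
    then have "i < N - int n" by (simp del: of_int_diff)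
    then have "i \<le> N - int (Suc n)" by simp
    then have "of_int i * pi \<le> of_int (N - int (Suc n)) * pi" by (intro mult_right_mono) (auto simp del: of_int_diff)
    then show ?case using i by (intro exI[of _ t]) simp
  qed
  define n where "n = nat \<lceil>of_int N + 1 - B / pi\<rceil>"
  have "of_int N + 1 - B / pi \<le> real n" unfolding n_def by linarith
  then have "(of_int N + 1 - B / pi) * pi \<le> real n * pi" by (intro mult_right_mono) auto
  then have "of_int (N - int n) * pi + pi \<le> B" by (simp add: algebra_simps)
  then have "of_int (N - int n) * pi + pi / 2 < B" using pi_gt_zero by linarith
  then show ?thesis using steps[of n] by (meson le_less_trans)
qed

text \<open>Let \<open>\<Theta> L\<close> be the phase angle at the turning point of the solution shifted by \<open>L\<close>. In the limit
\<open>exp (- 2 L) = 0\<close> the angle decreases without bound by \<open>autonomous_zeros\<close>. Continuity transfers any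
given amount of rotation to all large \<open>L\<close>, and \<open>angle_crosses_down\<close> ensures that it is not
undone before the turning point. So \<open>\<Theta> L\<close> tends to minus infinity and takes, for arbitrarily large \<open>L\<close>,
values in the first and in the third quadrant, where the solution escapes upwards and downwards.
The two sets of such \<open>L\<close> are open and disjoint, so they cannot cover an interval meeting
both. Any uncovered \<open>L\<close> gives a connection to \<open>0\<close>.\<close>

lemma connections_for_large_shift:
  fixes m :: nat and h v :: "real \<Rightarrow> real \<Rightarrow> real"
  assumes m: "2 \<le> m" "m \<le> 5"
    and hc: "continuous_on UNIV (\<lambda>q. h (fst q) (snd q))" and vc: "continuous_on UNIV (\<lambda>q. v (fst q) (snd q))"
    and osc: "\<And>e. oscillator m (damping e) (\<lambda>s. h s e) (\<lambda>s. v s e)"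
    and S: "\<And>s e. s \<le> S \<Longrightarrow> \<bar>h s e + pi / 2 - exp s\<bar> \<le> exp (2 * s) \<and> \<bar>v s e - exp s\<bar> \<le> 2 * exp (2 * s)"
    and L0: "0 \<le> L0"
  shows "\<exists>L\<ge>L0. oscillator m tanh (\<lambda>x. h (x + L) (exp (- 2 * L))) (\<lambda>x. v (x + L) (exp (- 2 * L))) \<and>
    (\<forall>x. \<bar>h (x + L) (exp (- 2 * L))\<bar> < pi / 2) \<and> ((\<lambda>x. h (x + L) (exp (- 2 * L))) \<longlongrightarrow> 0) at_top"
proof -
  have mr: "2 \<le> real m" "real m \<le> 5" "1 \<le> real m" using m by auto
  \<comment> \<open>From this time backwards \<open>early_in_strip\<close> applies for every parameter.\<close>
  define S' where "S' = min S (ln (1 / 100))"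
  have early: "\<bar>h s e\<bar> < pi / 2" "h s e < 0" "(v s e)\<^sup>2 < real m * (- damping e s) * (cos (h s e))\<^sup>2"
    if "s \<le> S'" for s e
    using early_in_strip[of m S h v s e, OF mr(1)] S that unfolding S'_def by blast+
  have moving: "h s e \<noteq> 0 \<or> v s e \<noteq> 0" for s e
  proof (rule ccontr)
    assume rest: "\<not> (h s e \<noteq> 0 \<or> v s e \<noteq> 0)"
    have "h (min s S') e = 0"
      using oscillator_rest[OF osc[of e] damping_bound mr(3), where b = s and s = "min s S'"] rest by simp
    then show False using early(2)[of "min s S'" e] by simp
  qed
  have "\<exists>R \<theta>. continuous_on UNIV \<theta> \<and>
      (\<forall>p. 0 < R p \<and> h (fst p) (snd p) = R p * cos (\<theta> p) \<and> v (fst p) (snd p) = R p * sin (\<theta> p))"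
    by (rule continuous_polar_lift[OF hc vc moving])
  then obtain R \<theta> where \<theta>: "continuous_on UNIV \<theta>"
    and polar': "\<forall>p. 0 < R p \<and> h (fst p) (snd p) = R p * cos (\<theta> p) \<and> v (fst p) (snd p) = R p * sin (\<theta> p)"
    by (elim exE conjE)
  note polar = polar'[rule_format]
  have comp: "continuous_on UNIV (\<lambda>q. f (a q, b q))"
    if "continuous_on UNIV f" "continuous_on UNIV a" "continuous_on UNIV b"
    for f :: "real \<times> real \<Rightarrow> real" and a b :: "'a::metric_space \<Rightarrow> real"
    by (rule continuous_on_compose2[OF that(1)]) (auto intro!: continuous_on_Pair that)
  have cross: "\<theta> (t, e) < \<alpha>" if "cos \<alpha> = 0" "\<theta> (s, e) \<le> \<alpha>" "s < t" for s t e \<alpha>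
  proof (rule angle_crosses_down[where h = "\<lambda>s. h s e" and v = "\<lambda>s. v s e" and \<theta> = "\<lambda>s. \<theta> (s, e)"
        and R = "\<lambda>s. R (s, e)" and s = s])
    show "continuous_on UNIV (\<lambda>s. \<theta> (s, e))" by (rule comp[OF \<theta> continuous_on_id continuous_on_const])
    show "((\<lambda>s. h s e) has_real_derivative v s e) (at s)" for s by (rule oscillatorD(1)[OF osc])
    show "0 < R (s, e) \<and> h s e = R (s, e) * cos (\<theta> (s, e)) \<and> v s e = R (s, e) * sin (\<theta> (s, e))" for s
      using polar[of "(s, e)"] by simp
  qed (rule that)+
  have descend0: "\<exists>s. \<theta> (s, 0) < B" for B
  proof (rule angle_unbounded_below[where \<theta> = "\<lambda>s. \<theta> (s, 0)"])
    show "\<theta> (t, 0) < \<alpha>" if "cos \<alpha> = 0" "\<theta> (s, 0) \<le> \<alpha>" "s < t" for s t \<alpha> by (rule cross[OF that])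
    have osc0: "oscillator m (\<lambda>_. - 1) (\<lambda>s. h s 0) (\<lambda>s. v s 0)" using osc[of 0] by (simp add: damping_0)
    have trap: "\<bar>h s 0\<bar> < pi / 2 \<and> (v s 0)\<^sup>2 < real m * (cos (h s 0))\<^sup>2" for s
    proof -
      have "\<bar>h s 0\<bar> < pi / 2 \<and> (v s 0)\<^sup>2 < real m * (- (- 1)) * (cos (h s 0))\<^sup>2"
        by (rule energy_trap[OF osc0, where T' = "\<lambda>_. 0" and a = "min s S'" and b = s])
          (use early(1,3)[of "min s S'" 0] mr in \<open>auto simp: damping_0\<close>)
      then show ?thesis by simp
    qed
    show "\<exists>s\<ge>Z. cos (\<theta> (s, 0)) = 0" for Z
    proof -
      obtain s where "Z \<le> s" "h s 0 = 0" using autonomous_zeros[OF osc0 mr(1,2) trap] by blast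
      moreover from this have "cos (\<theta> (s, 0)) = 0" using polar[of "(s, 0)"] by auto
      ultimately show ?thesis by blast
    qed
  qed
  define \<Theta> where "\<Theta> L = \<theta> (L, exp (- 2 * L))" for L
  have \<Theta>c: "continuous_on A \<Theta>" for A
    unfolding \<Theta>_def[abs_def]
    by (rule continuous_on_subset[of UNIV]) (auto intro!: comp[OF \<theta>] continuous_intros)
  have descend: "\<exists>L\<ge>L0. \<Theta> L < B" for B
  proof -
    define \<alpha> where "\<alpha> = of_int \<lfloor>B / pi - 1\<rfloor> * pi + pi / 2"
    have cos\<alpha>: "cos \<alpha> = 0" unfolding \<alpha>_def cos_zero_iff_int2 by blast
    have "of_int \<lfloor>B / pi - 1\<rfloor> * pi \<le> (B / pi - 1) * pi" by (intro mult_right_mono) auto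
    also have "\<dots> = B - pi" by (simp add: algebra_simps)
    finally have "\<alpha> < B" unfolding \<alpha>_def using pi_gt_zero by linarith
    obtain s0 where s0: "\<theta> (s0, 0) < \<alpha>" using descend0 by blast
    have "continuous_on UNIV (\<lambda>e. \<theta> (s0, e))" by (rule comp[OF \<theta> continuous_on_const continuous_on_id])
    then have "isCont (\<lambda>e. \<theta> (s0, e)) 0" by (simp add: continuous_on_eq_continuous_at)
    moreover have "((\<lambda>L::real. exp (- 2 * L)) \<longlongrightarrow> 0) at_top"
      by (intro filterlim_compose[OF exp_at_bot]
          filterlim_tendsto_neg_mult_at_bot[OF tendsto_const _ filterlim_ident]) simp
    ultimately have "((\<lambda>L. \<theta> (s0, exp (- 2 * L))) \<longlongrightarrow> \<theta> (s0, 0)) at_top"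
      by (rule isCont_tendsto_compose)
    then have "\<forall>\<^sub>F L in at_top. \<theta> (s0, exp (- 2 * L)) < \<alpha>" by (rule order_tendstoD(2)[OF _ s0])
    with eventually_gt_at_top[of s0] eventually_ge_at_top[of L0]
    have "\<forall>\<^sub>F L in at_top. L0 \<le> L \<and> \<Theta> L < B"
    proof eventually_elim
      case (elim L)
      then have "\<Theta> L < \<alpha>" unfolding \<Theta>_def by (intro cross[OF cos\<alpha>, of s0]) auto
      then show ?case using elim \<open>\<alpha> < B\<close> by simp
    qed
    then show ?thesis using eventually_happens'[OF trivial_limit_at_top_linorder] by blast
  qed
  define H where "H p = h (fst p + snd p) (exp (- 2 * snd p))" for p :: "real \<times> real"
  define V where "V p = v (fst p + snd p) (exp (- 2 * snd p))" for p :: "real \<times> real"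
  have HVc: "continuous_on UNIV H" "continuous_on UNIV V"
    unfolding H_def[abs_def] V_def[abs_def]
    using comp[OF hc, of "\<lambda>p. fst p + snd p" "\<lambda>p. exp (- 2 * snd p)"]
      comp[OF vc, of "\<lambda>p. fst p + snd p" "\<lambda>p. exp (- 2 * snd p)"]
    by (simp_all add: continuous_intros)
  have oscH: "oscillator m tanh (\<lambda>x. H (x, L)) (\<lambda>x. V (x, L))" if L: "0 \<le> L" for L
    unfolding oscillator_def
  proof (intro allI conjI)
    fix x
    show "((\<lambda>x. H (x, L)) has_real_derivative V (x, L)) (at x)"
      unfolding H_def V_def fst_conv snd_conv by (rule DERIV_shift[THEN iffD1], rule oscillatorD(1)[OF osc])
    have "((\<lambda>x. V (x, L)) has_real_derivative
        damping (exp (- 2 * L)) (x + L) * ((real m - 1) * V (x, L) + real m / 2 * sin (2 * H (x, L)))) (at x)"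
      unfolding H_def V_def fst_conv snd_conv by (rule DERIV_shift[THEN iffD1], rule oscillatorD(2)[OF osc])
    then show "((\<lambda>x. V (x, L)) has_real_derivative
        tanh x * ((real m - 1) * V (x, L) + real m / 2 * sin (2 * H (x, L)))) (at x)"
      unfolding damping_shift[OF L] .
  qed
  have left: "\<bar>H (x, L)\<bar> < pi / 2" if L: "0 \<le> L" and x: "x \<le> 0" for x L
  proof (rule strip_before_turning[OF oscH[OF L] mr(1) _ x, of "S' - L"])
    fix s assume "s \<le> S' - L"
    then have "s + L \<le> S'" by simp
    from early(1,3)[OF this, of "exp (- 2 * L)"]
    show "\<bar>H (s, L)\<bar> < pi / 2 \<and> (V (s, L))\<^sup>2 < real m * (- tanh s) * (cos (H (s, L)))\<^sup>2"
      unfolding H_def V_def fst_conv snd_conv damping_shift[OF L] by blast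
  qed
  define up where "up = {L. escapes_up (\<lambda>x. H (x, L)) (\<lambda>x. V (x, L))}"
  define down where "down = {L. escapes_up (\<lambda>x. - H (x, L)) (\<lambda>x. - V (x, L))}"
  have opens: "open up" "open down"
    unfolding up_def down_def
    by (rule open_escapes_up[OF HVc],
        rule open_escapes_up[OF continuous_on_minus[OF HVc(1)] continuous_on_minus[OF HVc(2)]])
  have at0: "H (0, L) = R (L, exp (- 2 * L)) * cos (\<Theta> L)" "V (0, L) = R (L, exp (- 2 * L)) * sin (\<Theta> L)"
    "0 < R (L, exp (- 2 * L))" for L
    using polar[of "(L, exp (- 2 * L))"] by (simp_all add: H_def V_def \<Theta>_def)
  \<comment> \<open>The last angle \<open>\<alpha>\<close> in the middle of the first quadrant such that \<open>\<alpha> + pi\<close>, in the third, is still below \<open>\<Theta> L0\<close>.\<close>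
  define k where "k = \<lfloor>(\<Theta> L0 - 5 * pi / 4) / (2 * pi)\<rfloor>"
  define \<alpha> where "\<alpha> = pi / 4 + of_int k * (2 * pi)"
  have "of_int k * (2 * pi) \<le> (\<Theta> L0 - 5 * pi / 4) / (2 * pi) * (2 * pi)"
    unfolding k_def by (intro mult_right_mono) auto
  then have \<alpha>: "\<alpha> + pi \<le> \<Theta> L0" by (simp add: \<alpha>_def)
  obtain L9 where L9: "L0 \<le> L9" "\<Theta> L9 < \<alpha>" using descend by blast
  obtain L1 where L1: "L0 \<le> L1" "L1 \<le> L9" "\<Theta> L1 = \<alpha>"
    using IVT2'[of \<Theta> L9 \<alpha> L0] L9 \<alpha> pi_gt_zero \<Theta>c by auto
  obtain L2 where L2: "L0 \<le> L2" "L2 \<le> L9" "\<Theta> L2 = \<alpha> + pi"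
    using IVT2'[of \<Theta> L9 "\<alpha> + pi" L0] L9 \<alpha> pi_gt_zero \<Theta>c by auto
  have trig: "0 < cos \<alpha>" "0 < sin \<alpha>"
  proof -
    have "cos \<alpha> = cos (pi / 4)" "sin \<alpha> = sin (pi / 4)"
      unfolding \<alpha>_def using sin_cos_eq_iff[of "pi / 4 + of_int k * (2 * pi)" "pi / 4"] by auto
    moreover have "0 < cos (pi / 4)" "0 < sin (pi / 4)" by (simp_all add: cos_45 sin_45)
    ultimately show "0 < cos \<alpha>" "0 < sin \<alpha>" by (simp_all only:)
  qed
  have "L1 \<in> up"
    unfolding up_def escapes_up_def mem_Collect_eq
    using at0[of L1] trig left[of L1 0] L1 L0 by (intro exI[of _ 0]) auto
  moreover have "L2 \<in> down"
    unfolding down_def escapes_up_def mem_Collect_eq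
    using at0[of L2] trig left[of L2 0] L2 L0 by (intro exI[of _ 0]) auto
  moreover have "connected {L0..L9}" by simp
  moreover have "up \<inter> down \<inter> {L0..L9} = {}"
    using escapes_exclusive[OF oscH mr(3)] L0 by (fastforce simp: up_def down_def)
  ultimately have "\<not> {L0..L9} \<subseteq> up \<union> down"
    using connectedD[of "{L0..L9}" up down] opens L1(1,2) L2(1,2) by (metis atLeastAtMost_iff disjoint_iff)
  then obtain L where "L \<in> {L0..L9}" and L': "L \<notin> up" "L \<notin> down" by blast
  then have L: "L0 \<le> L" "L \<notin> up" "L \<notin> down" by simp_all
  have L': "0 \<le> L" using L L0 by simp
  note oL = oscH[OF L'] and l0 = left[OF L' order_refl]
  have nu: "\<not> escapes_up (\<lambda>x. H (x, L)) (\<lambda>x. V (x, L))"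
    and nd: "\<not> escapes_up (\<lambda>x. - H (x, L)) (\<lambda>x. - V (x, L))" using L by (auto simp: up_def down_def)
  have strip: "\<bar>H (x, L)\<bar> < pi / 2" for x
    using left[OF L', of x] no_escape_strip[OF oL l0 nu nd, of x] by linarith
  have "((\<lambda>x. H (x, L)) \<longlongrightarrow> 0) at_top"
    by (rule no_escape_tendsto_0[OF oL mr(3) l0 nu nd]) (use moving in \<open>auto simp: H_def V_def\<close>)
  then show ?thesis using L(1) oL strip unfolding H_def V_def fst_conv snd_conv by blast
qed

section \<open>Solutions of the boundary value problem\<close>

lemma ode_solution_pullback:
  fixes m :: nat
  assumes osc: "oscillator m tanh H V"
  shows "ode_solution m m (\<lambda>t. - (H (ln (tan t)) + pi / 2))"
proof -
  define r' where "r' t = - (V (ln (tan t)) * inverse (sin t * cos t))" for t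
  have "((\<lambda>t. - (H (ln (tan t)) + pi / 2)) has_real_derivative r' t) (at t) \<and>
      (r' has_real_derivative ode_rhs m m t (- (H (ln (tan t)) + pi / 2)) (r' t)) (at t)"
    if t: "t \<in> {0<..<pi/2}" for t
  proof
    define s where "s = sin t"
    define c where "c = cos t"
    have s: "0 < s" and c: "0 < c" using t by (auto simp: s_def c_def intro!: sin_gt_zero cos_gt_zero)
    have sc: "s\<^sup>2 + c\<^sup>2 = 1" by (simp add: s_def c_def)
    have tan: "0 < tan t" using t by (simp add: tan_gt_zero)
    have x': "((\<lambda>t. ln (tan t)) has_real_derivative inverse (s * c)) (at t)"
    proof -
      have "((\<lambda>t. ln (tan t)) has_real_derivative inverse (tan t) * inverse ((cos t)\<^sup>2)) (at t)"
        using tan c by (auto intro!: derivative_eq_intros simp: c_def divide_inverse)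
      moreover have "inverse (tan t) * inverse ((cos t)\<^sup>2) = inverse (s * c)"
        using s c by (simp add: tan_def s_def c_def field_simps power2_eq_square)
      ultimately show ?thesis by simp
    qed
    define h where "h = H (ln (tan t))"
    define v where "v = V (ln (tan t))"
    have tanh: "tanh (ln (tan t)) = s\<^sup>2 - c\<^sup>2"
    proof -
      have "tanh (ln (tan t)) = ((tan t)\<^sup>2 - 1) / ((tan t)\<^sup>2 + 1)"
        using tan by (rule tanh_ln_real)
      also have "\<dots> = (s\<^sup>2 - c\<^sup>2) / (s\<^sup>2 + c\<^sup>2)"
        using c by (simp add: tan_def s_def c_def field_simps)
      finally show ?thesis using sc by simp
    qed
    have dH: "((\<lambda>t. H (ln (tan t))) has_real_derivative v * inverse (s * c)) (at t)"
      unfolding v_def by (rule DERIV_chain2[OF oscillatorD(1)[OF osc] x'])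
    have dV: "((\<lambda>t. V (ln (tan t))) has_real_derivative
        (s\<^sup>2 - c\<^sup>2) * ((real m - 1) * v + real m / 2 * sin (2 * h)) * inverse (s * c)) (at t)"
      using DERIV_chain2[OF oscillatorD(2)[OF osc] x'] unfolding tanh v_def[symmetric] h_def[symmetric] .
    have dsc: "((\<lambda>t. inverse (sin t * cos t)) has_real_derivative (s\<^sup>2 - c\<^sup>2) * (inverse (s * c))\<^sup>2) (at t)"
    proof -
      have "((\<lambda>t. sin t * cos t) has_real_derivative c\<^sup>2 - s\<^sup>2) (at t)"
        by (auto intro!: derivative_eq_intros simp: s_def c_def power2_eq_square)
      then have "((\<lambda>t. inverse (sin t * cos t)) has_real_derivative
          - (inverse (sin t * cos t) * (c\<^sup>2 - s\<^sup>2) * inverse (sin t * cos t))) (at t)"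
        by (rule DERIV_inverse') (use s c in \<open>simp add: s_def c_def\<close>)
      moreover have "- (i * (c\<^sup>2 - s\<^sup>2) * i) = (s\<^sup>2 - c\<^sup>2) * i\<^sup>2" for i
        by (simp add: power2_eq_square algebra_simps)
      ultimately show ?thesis by (simp only: s_def c_def)
    qed
    show "((\<lambda>t. - (H (ln (tan t)) + pi / 2)) has_real_derivative r' t) (at t)"
      using DERIV_minus[OF DERIV_add[OF dH DERIV_const[of "pi / 2"]]]
      by (simp add: r'_def v_def s_def c_def)
    have "(r' has_real_derivative - ((s\<^sup>2 - c\<^sup>2) * ((real m - 1) * v + real m / 2 * sin (2 * h)) * inverse (s * c) * inverse (s * c)
        + (s\<^sup>2 - c\<^sup>2) * (inverse (s * c))\<^sup>2 * v)) (at t)"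
      using DERIV_minus[OF DERIV_mult[OF dV dsc]] by (simp add: r'_def[abs_def] v_def s_def c_def)
    moreover have "- ((s\<^sup>2 - c\<^sup>2) * ((real m - 1) * v + real m / 2 * sin (2 * h)) * inverse (s * c) * inverse (s * c)
        + (s\<^sup>2 - c\<^sup>2) * (inverse (s * c))\<^sup>2 * v) = ode_rhs m m t (- (h + pi / 2)) (r' t)"
    proof -
      have sin: "sin (2 * - (h + pi / 2)) = sin (2 * h)"
      proof -
        have "2 * - (h + pi / 2) = - (2 * h + pi)" by simp
        then show ?thesis by (simp only: sin_minus sin_periodic_pi minus_minus)
      qed
      have cot: "cot (2 * t) = (c\<^sup>2 - s\<^sup>2) / (2 * s * c)"
        by (simp add: cot_def cos_double sin_double s_def c_def)
      have "ode_rhs m m t (- (h + pi / 2)) (r' t) =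
          - (2 * real m) * ((c\<^sup>2 - s\<^sup>2) / (2 * s * c)) * (- (v * inverse (s * c)))
          - real m * (sin (2 * h) / (2 * c\<^sup>2)) + real m * (sin (2 * h) / (2 * s\<^sup>2))"
        unfolding ode_rhs_def sin cot r'_def v_def[symmetric] s_def[symmetric] c_def[symmetric] by simp
      also have "\<dots> = - ((s\<^sup>2 - c\<^sup>2) * ((real m - 1) * v + real m / 2 * sin (2 * h)) * inverse (s * c) * inverse (s * c)
        + (s\<^sup>2 - c\<^sup>2) * (inverse (s * c))\<^sup>2 * v)"
        using s c by (simp add: field_simps power2_eq_square)
      finally show ?thesis by simp
    qed
    ultimately show "(r' has_real_derivative ode_rhs m m t (- (H (ln (tan t)) + pi / 2)) (r' t)) (at t)"
      by (simp only: h_def)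
  qed
  then show ?thesis unfolding ode_solution_def by blast
qed

lemma ln_tan_limits:
  "filterlim (\<lambda>t. ln (tan t)) at_bot (at_right (0::real))"
  "filterlim (\<lambda>t. ln (tan t)) at_top (at_left (pi / 2))"
proof -
  have "((\<lambda>t::real. tan t) \<longlongrightarrow> tan 0) (at_right 0)" by (intro tendsto_intros) auto
  moreover have "eventually (\<lambda>t::real. tan t \<in> {0<..}) (at_right 0)"
    using eventually_at_right_less[of 0] eventually_at_right_real[of 0 "pi / 2"]
    by (auto elim!: eventually_mono intro: tan_gt_zero)
  ultimately have "filterlim (tan :: real \<Rightarrow> real) (at_right 0) (at_right 0)"
    by (auto simp: filterlim_at elim: eventually_mono)
  then show "filterlim (\<lambda>t. ln (tan t)) at_bot (at_right (0::real))"
    by (rule filterlim_compose[OF ln_at_0])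
  show "filterlim (\<lambda>t. ln (tan t)) at_top (at_left (pi / 2))"
    by (rule filterlim_compose[OF ln_at_top filterlim_tan_at_left])
qed

text \<open>The function \<open>- (h + pi / 2)\<close> takes its values in \<open>{- pi<..<0}\<close>. It connects \<open>0\<close> to \<open>- pi / 2\<close>, which is the
admissible end value for \<open>l = - 1\<close>, and it oscillates about \<open>- pi / 2\<close> while staying away from \<open>pi / 2\<close>.\<close>

lemma connection_gives_bvp_solution:
  fixes m :: nat
  assumes osc: "oscillator m tanh H V" and bot: "(H \<longlongrightarrow> - (pi / 2)) at_bot" and top: "(H \<longlongrightarrow> 0) at_top"
    and strip: "\<And>x. \<bar>H x\<bar> < pi / 2"
  shows "bvp_solution m m (\<lambda>t. - (H (ln (tan t)) + pi / 2))" "nodal_number (\<lambda>t. - (H (ln (tan t)) + pi / 2)) = 0"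
proof -
  have "((\<lambda>t. - (H (ln (tan t)) + pi / 2)) \<longlongrightarrow> - (- (pi / 2) + pi / 2)) (at_right 0)"
    by (intro tendsto_intros filterlim_compose[OF bot ln_tan_limits(1)])
  moreover have "((\<lambda>t. - (H (ln (tan t)) + pi / 2)) \<longlongrightarrow> - (0 + pi / 2)) (at_left (pi / 2))"
    by (intro tendsto_intros filterlim_compose[OF top ln_tan_limits(2)])
  ultimately show "bvp_solution m m (\<lambda>t. - (H (ln (tan t)) + pi / 2))"
    unfolding bvp_solution_def using ode_solution_pullback[OF osc]
    by (intro conjI exI[of _ "- 1"]) simp_all
  have "- (H (ln (tan t)) + pi / 2) \<noteq> pi / 2" for t using strip[of "ln (tan t)"] by auto
  then show "nodal_number (\<lambda>t. - (H (ln (tan t)) + pi / 2)) = 0"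
    by (simp add: nodal_number_def zero_enat_def)
qed

theorem theoremB:
  fixes m :: nat
  assumes "2 \<le> m" and "m \<le> 5"
  shows "\<exists>r :: nat \<Rightarrow> real \<Rightarrow> real.
           (\<forall>k. bvp_solution m m (r k) \<and> nodal_number (r k) = 0) \<and>
           (\<forall>i j. i \<noteq> j \<longrightarrow> (\<exists>t\<in>{0<..<pi/2}. r i t \<noteq> r j t))"
proof -
  have "\<exists>h v. continuous_on UNIV (\<lambda>q. h (fst q) (snd q)) \<and> continuous_on UNIV (\<lambda>q. v (fst q) (snd q)) \<and>
    (\<forall>e. oscillator m (\<lambda>s. (clip e * exp (2 * s) - 1) / (clip e * exp (2 * s) + 1)) (\<lambda>s. h s e) (\<lambda>s. v s e)) \<and>
    (\<exists>S. \<forall>s\<le>S. \<forall>e. \<bar>h s e + pi / 2 - exp s\<bar> \<le> exp (2 * s) \<and> \<bar>v s e - exp s\<bar> \<le> 2 * exp (2 * s))"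
    by (rule unstable_manifold_family[OF _ clip_props(3,1,2)]) (use assms in simp)
  then obtain h v :: "real \<Rightarrow> real \<Rightarrow> real" and S where hc: "continuous_on UNIV (\<lambda>q. h (fst q) (snd q))"
    and vc: "continuous_on UNIV (\<lambda>q. v (fst q) (snd q))"
    and osc': "\<forall>e. oscillator m (\<lambda>s. (clip e * exp (2 * s) - 1) / (clip e * exp (2 * s) + 1)) (\<lambda>s. h s e) (\<lambda>s. v s e)"
    and S': "\<forall>s\<le>S. \<forall>e. \<bar>h s e + pi / 2 - exp s\<bar> \<le> exp (2 * s) \<and> \<bar>v s e - exp s\<bar> \<le> 2 * exp (2 * s)"
    by (elim exE conjE)
  have osc: "oscillator m (damping e) (\<lambda>s. h s e) (\<lambda>s. v s e)" for e
    using osc' by (simp add: damping_def[abs_def])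
  have S: "\<bar>h s e + pi / 2 - exp s\<bar> \<le> exp (2 * s) \<and> \<bar>v s e - exp s\<bar> \<le> 2 * exp (2 * s)" if "s \<le> S" for s e
    using S' that by blast
  define H where "H L x = h (x + L) (exp (- 2 * L))" for L x
  define V where "V L x = v (x + L) (exp (- 2 * L))" for L x
  define good where "good L \<longleftrightarrow> oscillator m tanh (H L) (V L) \<and> (\<forall>x. \<bar>H L x\<bar> < pi / 2) \<and> (H L \<longlongrightarrow> 0) at_top" for L
  have late: "\<exists>L\<ge>L0. good L" if "0 \<le> L0" for L0
    using connections_for_large_shift[OF assms hc vc osc S that] unfolding good_def H_def[abs_def] V_def[abs_def] by blast
  have asym: "\<bar>H L x + pi / 2 - exp (x + L)\<bar> \<le> exp (2 * (x + L))" if "x \<le> S - L" for x L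
    using S[of "x + L" "exp (- 2 * L)"] that by (simp add: H_def)
  have exp_bot: "((\<lambda>x. C * exp (x + L)) \<longlongrightarrow> 0) at_bot" for C L :: real
  proof -
    have "((\<lambda>x. C * exp L * exp x) \<longlongrightarrow> C * exp L * 0) at_bot" by (intro tendsto_intros exp_at_bot)
    then show ?thesis by (simp add: exp_add mult_ac)
  qed
  have bot: "(H L \<longlongrightarrow> - (pi / 2)) at_bot" for L
  proof -
    have "((\<lambda>x. H L x + pi / 2) \<longlongrightarrow> 0) at_bot"
    proof (rule Lim_null_comparison)
      show "\<forall>\<^sub>F x in at_bot. norm (H L x + pi / 2) \<le> 2 * exp (x + L)"
        using eventually_le_at_bot[of "min (S - L) (- L)"]
      proof eventually_elim
        case (elim x)
        have "exp (2 * (x + L)) \<le> exp (x + L)" using elim by simp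
        moreover have "x \<le> S - L" using elim by simp
        ultimately show ?case using asym[of x L] unfolding real_norm_def by linarith
      qed
    qed (rule exp_bot)
    from tendsto_diff[OF this tendsto_const[of "pi / 2"]] show ?thesis by simp
  qed
  \<comment> \<open>The shift is recovered from the behaviour \<open>H L x + pi / 2 ~ exp (x + L)\<close> at minus infinity.\<close>
  have distinct: "L = L'" if eq: "\<And>x. H L x = H L' x" for L L'
  proof -
    define C where "C = exp (2 * L) + exp (2 * L')"
    have "\<forall>\<^sub>F x in at_bot. \<bar>exp L - exp L'\<bar> \<le> C * exp (x + 0)"
      using eventually_le_at_bot[of "min (S - L) (S - L')"]
    proof eventually_elim
      case (elim x)
      have "\<bar>exp (x + L) - exp (x + L')\<bar> \<le> exp (2 * (x + L)) + exp (2 * (x + L'))"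
        using asym[of x L] asym[of x L'] elim eq[of x] by linarith
      moreover have "exp (x + L) - exp (x + L') = exp x * (exp L - exp L')"
        "exp (2 * (x + L)) + exp (2 * (x + L')) = exp x * (C * exp x)"
        unfolding C_def exp_double exp_add by (simp_all add: algebra_simps power2_eq_square)
      ultimately show ?case by (simp add: abs_mult)
    qed
    then have "\<bar>exp L - exp L'\<bar> \<le> 0"
      by (rule tendsto_lowerbound[OF exp_bot]) simp
    then show ?thesis by simp
  qed
  have "infinite {L. good L}"
  proof
    assume fin: "finite {L. good L}"
    obtain L where L: "max 0 (Max (insert 0 {L. good L})) + 1 \<le> L" "good L"
      using late[of "max 0 (Max (insert 0 {L. good L})) + 1"] by auto
    have "L \<le> Max (insert 0 {L. good L})" using fin L(2) by (intro Max_ge) auto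
    then show False using L(1) by linarith
  qed
  then obtain f :: "nat \<Rightarrow> real" where f: "inj f" "range f \<subseteq> {L. good L}"
    using infinite_countable_subset by blast
  define r where "r k t = - (H (f k) (ln (tan t)) + pi / 2)" for k t
  show ?thesis
  proof (intro exI[of _ r] conjI allI impI)
    fix k
    have "good (f k)" using f(2) by auto
    then show "bvp_solution m m (r k)" "nodal_number (r k) = 0"
      using connection_gives_bvp_solution[of m "H (f k)" "V (f k)"] bot[of "f k"]
      unfolding good_def r_def[abs_def] by blast+
  next
    fix i j :: nat assume "i \<noteq> j"
    then have "f i \<noteq> f j" using f(1) by (auto dest: injD)
    then obtain x where x: "H (f i) x \<noteq> H (f j) x" using distinct by blast
    have "ln (tan (arctan (exp x))) = x" by (simp add: tan_arctan)
    moreover have "arctan (exp x) \<in> {0<..<pi/2}" using arctan_ubound[of "exp x"] by simp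
    ultimately show "\<exists>t\<in>{0<..<pi/2}. r i t \<noteq> r j t"
      using x by (intro bexI[of _ "arctan (exp x)"]) (auto simp: r_def)
  qed
qed

end
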